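(* Let $L$ be a positive integer divisible by at least $4$ distinct primes. For each $n\ge 1$ let \[ f = X^n + \sum_{i=0}^{n-1} \zeta_i X^i, \] where $\zeta_0,\zeta_1,\ldots,\zeta_{n-1}$ are independent random variables, each uniformly distributed on $\{1,\ldots,L\}$. Then \[ \lim_{n\to\infty} \mathbb{P}(f \text{ is irreducible over } \mathbb{Q}) = 1. \] *)

theory Defs
  imports "HOL-Probability.Probability" "HOL-Computational_Algebra.Computational_Algebra"
begin

definition monic_poly :: "nat \<Rightarrow> (nat \<Rightarrow> int) \<Rightarrow> rat poly" where
  "monic_poly n c = monom 1 n + (\<Sum>i<n. monom (of_int (c i)) i)"

end

(*
  A monic factor of f of degree k <= n/2 over the integers gives a factor of degree k of f modulo each
  of four primes dividing L, and these four reductions are independent and uniform. A uniform monic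
  polynomial over a prime field has, up to small probability, at most c * log_2 k irreducible factors
  of degree at most k for all large k, where ln 2 < c < 3/4. On this event the expected number of its
  divisors of degree k is O(k^(c - 1)): weight every divisor by 2^(c * log_2 k) * 2^(-Omega_k(f)), where
  Omega_k counts the irreducible factors of degree at most k. By independence the four reductions
  have a common divisor degree k >= K with probability at most the sum of O(k^(4 * c - 4)) over k >= K,
  which tends to 0 as K grows.

  Factors of degree at most K are excluded directly. The roots of f are bounded, so only finitely many
  algebraic integers can be roots of such factors, and a fixed nonzero number is a root of f with
  probability tending to 0.
*)
theory Submission
  imports Defs "Berlekamp_Zassenhaus.Finite_Field" "Berlekamp_Zassenhaus.Factor_Bound"
begin

hide_const (open) Divisibility.irreducible Divisibility.prime up_ring.monom up_ring.coeff
  comm_monoid_mult_class.coprime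

text \<open>The number of degree-k divisors of a random monic polynomial over a prime field has mean
  exactly 1, but this mean is carried by rare polynomials with very many factors; on typical ones a
  power of k is saved. With weight 1/2 per irreducible of degree at most k, the generating function
  behaves up to degree k like (1 - q u) powr (- 1 / 2), so a divisor and its cofactor each average
  O(k^(- 1 / 2)); k <= n/2 keeps the degree of the cofactor at least k. The number of factors of
  degree at most k has mean about ln k = ln 2 * log_2 k, which forces c > ln 2, and r primes need r
  * (1 - c) > 1 for summability. Because 3 * (1 - ln 2) < 1 < 4 * (1 - ln 2), four is the smallest
  number of primes for which such a c exists. All that the estimates use about the field is that
  there are q ^ n monic polynomials of degree n, so they are uniform in the prime.\<close>

section \<open>Random multisets of primes\<close>

text \<open>The coefficients of the power series \<open>(1 - u) powr (- 1 / 2)\<close>.\<close>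

fun cbin :: "nat \<Rightarrow> real" where
  "cbin 0 = 1"
| "cbin (Suc n) = cbin n * (2 * real n + 1) / (2 * real n + 2)"

lemma cbin_pos: "cbin n > 0"
  by (induction n) auto

text \<open>This is the recurrence n * a n = 1/2 * (a 0 + ... + a (n - 1)), which makes
  \<open>cbin\<close> the majorant for \<open>half_avg\<close>.\<close>

lemma sum_cbin: "(\<Sum>j<n. cbin j) = 2 * real n * cbin n"
  by (induction n) (auto simp: field_simps)

text \<open>A Wallis bound: the square of \<open>cbin n\<close> times 2 n + 1 equals 1 at n = 0 and
  decreases, as (2 n + 1) (2 n + 3) < (2 n + 2)^2.\<close>

lemma cbin_le: "cbin n \<le> 1 / sqrt (2 * real n + 1)"
proof -
  have *: "(cbin n)\<^sup>2 * (2 * real n + 1) \<le> 1"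
  proof (induction n)
    case (Suc n)
    have "(cbin (Suc n))\<^sup>2 * (2 * real (Suc n) + 1) =
       ((cbin n)\<^sup>2 * (2 * real n + 1)) * ((2 * real n + 1) * (2 * real n + 3) / (2 * real n + 2)\<^sup>2)"
      by (simp add: power2_eq_square algebra_simps add_divide_distrib)
    also have "\<dots> \<le> 1 * 1"
    proof (intro mult_mono Suc)
      show "(2 * real n + 1) * (2 * real n + 3) / (2 * real n + 2)\<^sup>2 \<le> 1"
      proof -
        have "(2 * real n + 1) * (2 * real n + 3) \<le> (2 * real n + 2)\<^sup>2"
          by (simp add: power2_eq_square algebra_simps)
        thus ?thesis by (simp add: divide_le_eq_1)
      qed
    qed auto
    finally show ?case by simp
  qed simp
  have "sqrt ((cbin n)\<^sup>2 * (2 * real n + 1)) \<le> 1" using * by simp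
  hence "cbin n * sqrt (2 * real n + 1) \<le> 1" using cbin_pos[of n] by (simp add: real_sqrt_mult)
  thus ?thesis by (simp add: field_simps)
qed

text \<open>
  Monic polynomials over the field with \<open>q\<close> elements, seen through unique factorization as multisets of
  irreducibles: only the number \<open>q ^ n\<close> of objects of each degree matters.
\<close>

locale prime_system =
  fixes Pr :: "'a set" and dg :: "'a \<Rightarrow> nat" and q :: nat
  assumes dg_pos: "P \<in> Pr \<Longrightarrow> dg P > 0"
    and q_ge_2: "q \<ge> 2"
    and card_W': "card {M. set_mset M \<subseteq> Pr \<and> (\<Sum>P\<in>#M. dg P) = n} = q ^ n"
begin

definition wt :: "'a multiset \<Rightarrow> nat" where
  "wt M = (\<Sum>P\<in>#M. dg P)"

definition W :: "nat \<Rightarrow> 'a multiset set" where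
  "W n = {M. set_mset M \<subseteq> Pr \<and> wt M = n}"

definition small :: "nat \<Rightarrow> 'a multiset \<Rightarrow> nat" where
  "small K M = size (filter_mset (\<lambda>P. dg P \<le> K) M)"

definition powers :: "nat \<Rightarrow> ('a \<times> nat) set" where
  "powers m = {(P, j). P \<in> Pr \<and> j \<ge> 1 \<and> j * dg P = m}"

lemma wt_simps [simp]: "wt {#} = 0" "wt (A + B) = wt A + wt B" "wt (replicate_mset j P) = j * dg P"
  by (auto simp: wt_def)

lemma small_simps [simp]: "small K {#} = 0" "small K (A + B) = small K A + small K B"
  by (auto simp: small_def)

lemma card_W: "card (W n) = q ^ n"
  using card_W' by (simp add: W_def wt_def)

lemma finite_W [simp]: "finite (W n)"
proof -
  \<comment> \<open>An infinite set has \<open>card\<close> 0, so a positive count already gives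
    finiteness.\<close>
  have "card (W n) > 0" using card_W q_ge_2 by simp
  thus ?thesis using card_gt_0_iff by blast
qed

lemma wt_conv_sum: "wt M = (\<Sum>P\<in>set_mset M. count M P * dg P)"
proof -
  \<comment> \<open>A fixed index set A keeps the sum comparable when the induction adds an element
    to M.\<close>
  have "wt M = (\<Sum>P\<in>A. count M P * dg P)" if "finite A" "set_mset M \<subseteq> A" for A
    using that(2)
  proof (induction M)
    case (add P M)
    have "(\<Sum>Q\<in>A. count (add_mset P M) Q * dg Q) = (\<Sum>Q\<in>A. count M Q * dg Q + (if Q = P then dg Q else 0))"
      by (intro sum.cong) auto
    with add that(1) show ?case by (simp add: sum.distrib wt_def)
  qed (simp add: wt_def)
  thus ?thesis by simp
qed

lemma finite_deg: "finite {P \<in> Pr. dg P = d}"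
proof -
  have "(\<lambda>P. {#P#}) ` {P \<in> Pr. dg P = d} \<subseteq> W d" by (auto simp: W_def wt_def)
  hence "finite ((\<lambda>P. {#P#}) ` {P \<in> Pr. dg P = d})" using finite_W finite_subset by blast
  thus ?thesis by (rule finite_imageD) (auto simp: inj_on_def)
qed

lemma finite_deg_le: "finite {P \<in> Pr. dg P \<le> d}"
proof -
  have "{P \<in> Pr. dg P \<le> d} = (\<Union>e\<le>d. {P \<in> Pr. dg P = e})" by auto
  thus ?thesis using finite_deg by simp
qed

lemma finite_powers [simp]: "finite (powers m)"
proof -
  have "powers m \<subseteq> {P \<in> Pr. dg P \<le> m} \<times> {..m}"
    using dg_pos by (auto simp: powers_def Suc_le_eq)
  thus ?thesis by (rule finite_subset) (simp add: finite_deg_le)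
qed

lemma wt_diff: "A \<subseteq># M \<Longrightarrow> wt (M - A) = wt M - wt A"
  by (metis add_diff_cancel_left' subset_mset.add_diff_inverse wt_simps(2))

lemma wt_mono: "A \<subseteq># M \<Longrightarrow> wt A \<le> wt M"
  by (metis le_add1 subset_mset.add_diff_inverse wt_simps(2))

lemma sum_W_superset:
  assumes "set_mset A \<subseteq> Pr" "wt A \<le> n"
  shows "(\<Sum>M | M \<in> W n \<and> A \<subseteq># M. F M) = (\<Sum>B\<in>W (n - wt A). F (A + B))"
proof -
  have "bij_betw (\<lambda>B. A + B) (W (n - wt A)) {M. M \<in> W n \<and> A \<subseteq># M}"
  proof (rule bij_betwI[where g = "\<lambda>M. M - A"])
    show "(\<lambda>B. A + B) \<in> W (n - wt A) \<rightarrow> {M. M \<in> W n \<and> A \<subseteq># M}"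
      using assms by (auto simp: W_def)
    show "(\<lambda>M. M - A) \<in> {M. M \<in> W n \<and> A \<subseteq># M} \<rightarrow> W (n - wt A)"
      by (auto simp: W_def wt_diff dest: in_diffD)
  qed auto
  thus ?thesis using sum.reindex_bij_betw[of _ "W (n - wt A)" _ F] by metis
qed

text \<open>Removing A leaves an arbitrary multiset of weight n - wt A. Equality fails only for wt A
  > n, where there is no superset at all.\<close>

lemma card_superset_le:
  assumes "set_mset A \<subseteq> Pr"
  shows "real (card {M \<in> W n. A \<subseteq># M}) \<le> real q ^ n / real q ^ wt A"
proof (cases "wt A \<le> n")
  case True
  have "real (card {M \<in> W n. A \<subseteq># M}) = (\<Sum>M | M \<in> W n \<and> A \<subseteq># M. 1)" by simp
  also have "\<dots> = real (card (W (n - wt A)))"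
    by (subst sum_W_superset[OF assms True]) simp
  also have "\<dots> = real q ^ n / real q ^ wt A"
  proof -
    have "real q ^ n = real q ^ (n - wt A) * real q ^ wt A" using True by (simp flip: power_add)
    thus ?thesis using q_ge_2 by (simp only: card_W of_nat_power) simp
  qed
  finally show ?thesis by simp
next
  case False
  hence *: "{M \<in> W n. A \<subseteq># M} = {}" using wt_mono by (auto simp: W_def)
  show ?thesis unfolding * by simp
qed

text \<open>The analogue of log n being the sum of the von Mangoldt function over the divisors of n:
  each prime contributes its degree once for every power of it that divides M.\<close>

lemma wt_eq_sum_powers:
  assumes "M \<in> W n"
  shows "n = (\<Sum>m=1..n. \<Sum>(P,j)\<in>powers m. if j \<le> count M P then dg P else 0)"
proof -
  have "n = (\<Sum>P\<in>set_mset M. count M P * dg P)"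
    using assms by (simp add: W_def wt_conv_sum)
  also have "\<dots> = (\<Sum>P\<in>set_mset M. \<Sum>j\<in>{1..count M P}. dg P)" by simp
  also have "\<dots> = (\<Sum>(P,j)\<in>(SIGMA P:set_mset M. {1..count M P}). dg P)"
    by (subst sum.Sigma) auto
  also have "\<dots> = (\<Sum>(m,P,j)\<in>(SIGMA m:{1..n}. {x\<in>powers m. snd x \<le> count M (fst x)}). dg P)"
  proof (rule sum.reindex_bij_witness[where i = "\<lambda>(m,P,j). (P,j)" and j = "\<lambda>(P,j). (j * dg P, P, j)"])
    fix a assume a: "a \<in> (SIGMA P:set_mset M. {1..count M P})"
    obtain P j where Pj: "a = (P, j)" by (cases a)
    have P: "P \<in> Pr" "j \<ge> 1" "j \<le> count M P" using a assms Pj by (auto simp: W_def)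
    have "replicate_mset j P \<subseteq># M" using P by (simp add: count_le_replicate_mset_subset_eq)
    hence "j * dg P \<le> n" using wt_mono assms by (fastforce simp: W_def)
    thus "(case a of (P,j) \<Rightarrow> (j * dg P, P, j)) \<in> (SIGMA m:{1..n}. {x\<in>powers m. snd x \<le> count M (fst x)})"
      using P Pj dg_pos[of P] by (auto simp: powers_def Suc_le_eq)
  next
    fix b assume "b \<in> (SIGMA m:{1..n}. {x\<in>powers m. snd x \<le> count M (fst x)})"
    thus "(case b of (m,P,j) \<Rightarrow> (P,j)) \<in> (SIGMA P:set_mset M. {1..count M P})"
      by (auto simp: powers_def simp flip: count_greater_zero_iff)
  qed (auto simp: powers_def)
  also have "\<dots> = (\<Sum>m=1..n. \<Sum>(P,j)\<in>{x\<in>powers m. snd x \<le> count M (fst x)}. dg P)"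
    by (subst sum.Sigma) (auto simp: case_prod_unfold)
  also have "\<dots> = (\<Sum>m=1..n. \<Sum>(P,j)\<in>powers m. if j \<le> count M P then dg P else 0)"
    by (simp add: case_prod_unfold sum.inter_filter)
  finally show ?thesis .
qed

section \<open>Weighted counts and the number of primes of each degree\<close>

definition S :: "('a \<Rightarrow> real) \<Rightarrow> nat \<Rightarrow> real" where
  "S w n = (\<Sum>M\<in>W n. \<Prod>P\<in>#M. w P)"

text \<open>A pair (P, j) stands for the prime power P ^ j, whose von Mangoldt value is
  \<open>dg P\<close>; the weight w is extended multiplicatively.\<close>

definition mangoldt_sum :: "('a \<Rightarrow> real) \<Rightarrow> nat \<Rightarrow> real" where
  "mangoldt_sum w m = (\<Sum>(P,j)\<in>powers m. real (dg P) * w P ^ j)"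

text \<open>
  The coefficient form of the logarithmic derivative of the Euler product of the weighted
  generating function.
\<close>

lemma S_recurrence: "real n * S w n = (\<Sum>m=1..n. mangoldt_sum w m * S w (n - m))"
proof -
  let ?F = "\<lambda>M. \<Prod>P\<in>#M. w P"
  have "real n * S w n = (\<Sum>M\<in>W n. (\<Sum>m=1..n. \<Sum>(P,j)\<in>powers m. (if j \<le> count M P then real (dg P) else 0)) * ?F M)"
    unfolding S_def sum_distrib_left
  proof (intro sum.cong refl)
    fix M assume "M \<in> W n"
    hence "real n = real (\<Sum>m=1..n. \<Sum>(P,j)\<in>powers m. if j \<le> count M P then dg P else 0)"
      using wt_eq_sum_powers by presburger
    also have "\<dots> = (\<Sum>m=1..n. \<Sum>(P,j)\<in>powers m. (if j \<le> count M P then real (dg P) else 0))"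
      unfolding of_nat_sum by (intro sum.cong refl) (auto split: prod.splits)
    finally show "real n * ?F M = (\<Sum>m=1..n. \<Sum>(P,j)\<in>powers m. (if j \<le> count M P then real (dg P) else 0)) * ?F M"
      by simp
  qed
  also have "\<dots> = (\<Sum>m=1..n. \<Sum>(P,j)\<in>powers m. \<Sum>M\<in>W n. (if j \<le> count M P then real (dg P) * ?F M else 0))"
    unfolding sum_distrib_right case_prod_unfold
    apply (subst sum.swap)
    apply (intro sum.cong refl)
    apply (subst sum.swap)
    apply (intro sum.cong refl)
    by simp
  also have "\<dots> = (\<Sum>m=1..n. mangoldt_sum w m * S w (n - m))"
    unfolding mangoldt_sum_def sum_distrib_right
  proof (intro sum.cong refl)
    fix m x assume m: "m \<in> {1..n}" and x: "x \<in> powers m"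
    obtain P j where Pj: "x = (P,j)" by (cases x)
    have P: "P \<in> Pr" "j \<ge> 1" "j * dg P = m" using x Pj by (auto simp: powers_def)
    have "(\<Sum>M\<in>W n. (if j \<le> count M P then real (dg P) * ?F M else 0))
        = (\<Sum>M | M \<in> W n \<and> replicate_mset j P \<subseteq># M. real (dg P) * ?F M)"
      by (simp add: sum.inter_filter count_le_replicate_mset_subset_eq)
    also have "\<dots> = (\<Sum>M\<in>W (n - m). real (dg P) * ?F (replicate_mset j P + M))"
      using P m by (subst sum_W_superset) auto
    also have "\<dots> = real (dg P) * w P ^ j * S w (n - m)"
      by (simp add: S_def sum_distrib_left mult.assoc)
    finally show "(case x of (P,j) \<Rightarrow> \<Sum>M\<in>W n. (if j \<le> count M P then real (dg P) * ?F M else 0))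
       = (case x of (P,j) \<Rightarrow> real (dg P) * w P ^ j) * S w (n - m)"
      by (simp add: Pj)
  qed
  finally show ?thesis .
qed

lemma S_one: "S (\<lambda>_. 1) n = real q ^ n"
  by (simp add: S_def card_W)

text \<open>The prime polynomial theorem in exact form. In \<open>S_recurrence\<close> the left side
  is n * q ^ n, and by induction each of the n - 1 terms with m < n equals q ^ n, which leaves q ^ n
  for the last.\<close>

lemma mangoldt_sum_one: "m \<ge> 1 \<Longrightarrow> mangoldt_sum (\<lambda>_. 1) m = real q ^ m"
proof (induction m rule: less_induct)
  case (less n)
  have "real n * real q ^ n = (\<Sum>m=1..n. mangoldt_sum (\<lambda>_. 1) m * real q ^ (n - m))"
    using S_recurrence[of n "\<lambda>_. 1"] by (simp add: S_one)
  also have "{1..n} = insert n {1..<n}" using less.prems by auto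
  also have "(\<Sum>m\<in>insert n {1..<n}. mangoldt_sum (\<lambda>_. 1) m * real q ^ (n - m)) =
      mangoldt_sum (\<lambda>_. 1) n + (\<Sum>m=1..<n. mangoldt_sum (\<lambda>_. 1) m * real q ^ (n - m))" by simp
  also have "(\<Sum>m=1..<n. mangoldt_sum (\<lambda>_. 1) m * real q ^ (n - m)) = (\<Sum>m=1..<n. real q ^ n)"
    using less.IH by (intro sum.cong) (auto simp flip: power_add)
  also have "\<dots> = (real n - 1) * real q ^ n" using less.prems by (simp add: of_nat_diff)
  finally show ?case by (simp add: algebra_simps)
qed

text \<open>Since weights lie in [0, 1], w P ^ j <= w P, so a bound on the primes of degree at most
  m passes to all prime powers of degree m.\<close>

lemma mangoldt_sum_le:
  assumes "\<And>P. P \<in> Pr \<Longrightarrow> 0 \<le> w P \<and> w P \<le> 1" "\<And>P. P \<in> Pr \<Longrightarrow> dg P \<le> m \<Longrightarrow> w P \<le> c" "m \<ge> 1"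
  shows "mangoldt_sum w m \<le> c * real q ^ m"
proof -
  have "mangoldt_sum w m \<le> (\<Sum>(P,j)\<in>powers m. c * (real (dg P) * 1 ^ j))"
    unfolding mangoldt_sum_def
  proof (intro sum_mono, clarify)
    fix P j assume "(P,j) \<in> powers m"
    hence P: "P \<in> Pr" "j \<ge> 1" "j * dg P = m" by (auto simp: powers_def)
    have "dg P \<le> m" using mult_le_mono1[of 1 j "dg P"] P by simp
    hence "w P \<le> c" using assms P by blast
    moreover have "w P ^ j \<le> w P ^ 1" using P assms(1)[of P] by (intro power_decreasing) auto
    ultimately have "w P ^ j \<le> c" by simp
    thus "real (dg P) * w P ^ j \<le> c * (real (dg P) * 1 ^ j)"
      using mult_left_mono[of "w P ^ j" c "real (dg P)"] by (simp add: mult.commute)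
  qed
  also have "\<dots> = c * mangoldt_sum (\<lambda>_. 1) m"
    by (simp add: mangoldt_sum_def sum_distrib_left case_prod_unfold)
  finally show ?thesis using mangoldt_sum_one assms by simp
qed

section \<open>Weight 1/2 on small primes, and divisors of a given weight\<close>

definition halfw :: "nat \<Rightarrow> 'a \<Rightarrow> real" where
  "halfw K P = (if dg P \<le> K then 1 / 2 else 1)"

lemma prod_halfw: "(\<Prod>P\<in>#M. halfw K P) = (1 / 2) ^ small K M"
  by (induction M) (auto simp: small_def halfw_def)

text \<open>By \<open>prod_halfw\<close>, the mean of (1/2) ^ \<open>small K M\<close> for M uniform
  in \<open>W n\<close>.\<close>

definition half_avg :: "nat \<Rightarrow> nat \<Rightarrow> real" where
  "half_avg K n = S (halfw K) n / real q ^ n"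

lemma half_avg_nonneg: "half_avg K n \<ge> 0"
  by (auto simp: half_avg_def S_def prod_halfw intro!: divide_nonneg_nonneg sum_nonneg)

lemma half_avg_0: "half_avg K 0 = 1"
proof -
  have "W 0 = {{#}}"
  proof (intro equalityI subsetI)
    fix M assume M: "M \<in> W 0"
    have "False" if "P \<in># M" for P
      using that M dg_pos[of P] by (auto simp: W_def wt_def)
    thus "M \<in> {{#}}" by (metis multiset_nonemptyE singletonI)
  qed (auto simp: W_def)
  thus ?thesis by (simp add: half_avg_def S_def)
qed

text \<open>\<open>S_recurrence\<close> divided by q ^ n, with j = n - m; the prime powers of degree
  m <= K all have weight at most 1/2.\<close>

lemma half_avg_recurrence: "real n * half_avg K n \<le> (\<Sum>j<n. (if n - j \<le> K then 1 / 2 else 1) * half_avg K j)"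
proof -
  have q: "real q ^ k > 0" for k using q_ge_2 by simp
  have S_nn: "S (halfw K) k \<ge> 0" for k
    using half_avg_nonneg[of K k] q[of k] by (simp add: half_avg_def zero_le_divide_iff)
  have "real n * half_avg K n = (\<Sum>m=1..n. mangoldt_sum (halfw K) m * S (halfw K) (n - m)) / real q ^ n"
    using S_recurrence[of n "halfw K"] by (simp add: half_avg_def)
  also have "\<dots> \<le> (\<Sum>m=1..n. ((if m \<le> K then 1 / 2 else 1) * real q ^ m) * S (halfw K) (n - m)) / real q ^ n"
  proof (intro divide_right_mono sum_mono mult_right_mono S_nn)
    fix m assume "m \<in> {1..n}"
    thus "mangoldt_sum (halfw K) m \<le> (if m \<le> K then 1 / 2 else 1) * real q ^ m"
      by (intro mangoldt_sum_le) (auto simp: halfw_def)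
  qed (use q in simp)
  also have "\<dots> = (\<Sum>m=1..n. (if m \<le> K then 1 / 2 else 1) * half_avg K (n - m))"
    unfolding sum_divide_distrib half_avg_def
  proof (intro sum.cong refl)
    fix m assume m: "m \<in> {1..n}"
    have "real q ^ n = real q ^ m * real q ^ (n - m)" using m by (simp flip: power_add)
    thus "(if m \<le> K then 1 / 2 else 1) * real q ^ m * S (halfw K) (n - m) / real q ^ n =
      (if m \<le> K then 1 / 2 else 1) * (S (halfw K) (n - m) / real q ^ (n - m))"
      using q_ge_2 by (simp only: ) simp
  qed
  also have "\<dots> = (\<Sum>j<n. (if n - j \<le> K then 1 / 2 else 1) * half_avg K j)"
    by (rule sum.reindex_bij_witness[where i = "\<lambda>j. n - j" and j = "\<lambda>m. n - m"]) auto
  finally show ?thesis .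
qed

text \<open>For n <= K every factor in the recurrence is 1/2, and \<open>sum_cbin\<close> says that
  \<open>cbin\<close> solves this recurrence with equality.\<close>

lemma half_avg_le: "n \<le> K \<Longrightarrow> half_avg K n \<le> cbin n"
proof (induction n rule: less_induct)
  case (less n)
  show ?case
  proof (cases "n = 0")
    case False
    have "real n * half_avg K n \<le> (\<Sum>j<n. (if n - j \<le> K then 1 / 2 else 1) * half_avg K j)" by (rule half_avg_recurrence)
    also have "\<dots> \<le> (\<Sum>j<n. 1 / 2 * cbin j)"
      using less half_avg_nonneg by (intro sum_mono mult_mono) auto
    also have "\<dots> = real n * cbin n" by (simp add: sum_cbin flip: sum_divide_distrib)
    finally show ?thesis using False by simp
  qed (simp add: half_avg_0)
qed

text \<open>With factors at most 1, each term is at most the mean \<open>T n / n\<close> of its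
  predecessors, so this running mean cannot increase beyond n = K, where \<open>sum_cbin\<close>
  bounds it.\<close>

lemma half_avg_ge:
  assumes "K \<ge> 1" "n \<ge> K"
  shows "half_avg K n \<le> 2 * cbin K"
proof -
  define T where "T n = (\<Sum>j<n. half_avg K j)" for n
  have sT: "real n * half_avg K n \<le> T n" for n
  proof -
    have "real n * half_avg K n \<le> (\<Sum>j<n. (if n - j \<le> K then 1 / 2 else 1) * half_avg K j)" by (rule half_avg_recurrence)
    also have "\<dots> \<le> (\<Sum>j<n. 1 * half_avg K j)"
      using half_avg_nonneg by (intro sum_mono mult_right_mono) auto
    finally show ?thesis by (simp add: T_def)
  qed
  have "T n / real n \<le> T K / real K"
    using assms(2)
  proof (induction n rule: dec_induct)
    case (step n)
    have n: "real n > 0" using step assms by simp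
    have "T (Suc n) = T n + half_avg K n" by (simp add: T_def)
    also have "\<dots> \<le> T n + T n / real n" using sT[of n] n by (simp add: pos_le_divide_eq mult.commute)
    also have "\<dots> = (T n / real n) * real (Suc n)" using n by (simp add: distrib_left)
    finally have "T (Suc n) / real (Suc n) \<le> T n / real n" by (subst pos_divide_le_eq) auto
    thus ?case using step by simp
  qed simp
  moreover have "T K \<le> (\<Sum>j<K. cbin j)" unfolding T_def by (intro sum_mono half_avg_le) auto
  hence "T K / real K \<le> 2 * cbin K" using assms by (simp add: sum_cbin pos_divide_le_eq mult_ac)
  moreover have "half_avg K n \<le> T n / real n" using sT[of n] assms by (simp add: pos_le_divide_eq mult.commute)
  ultimately show ?thesis by linarith
qed

text \<open>Rankin's trick: where \<open>small k M\<close> <= t, the factor 2 powr t * (1/2) ^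
  \<open>small k M\<close> is at least 1. Counting M once per decomposition M = A + B, the
  multiplicative weight splits the sum into two averages of size O(k^(- 1 / 2)); 2 * k <= n puts B
  in the range of \<open>half_avg_ge\<close>.\<close>

lemma card_divisor_le:
  assumes k: "k \<ge> 1" "2 * k \<le> n"
  shows "real (card {M \<in> W n. (\<exists>A. A \<subseteq># M \<and> wt A = k) \<and> real (small k M) \<le> t}) \<le> 2 powr t / real k * real q ^ n"
proof -
  let ?X = "{M \<in> W n. (\<exists>A. A \<subseteq># M \<and> wt A = k) \<and> real (small k M) \<le> t}"
  let ?w = "halfw k"
  let ?g = "\<lambda>M. 2 powr t * (1 / 2) ^ small k M :: real"
  have "real (card ?X) = (\<Sum>M\<in>?X. 1)" by simp
  also have "\<dots> \<le> (\<Sum>M\<in>?X. ?g M)"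
  proof (intro sum_mono)
    fix M assume "M \<in> ?X"
    hence "2 powr real (small k M) \<le> 2 powr t" by (intro powr_mono) auto
    thus "1 \<le> ?g M" by (simp add: powr_realpow power_one_over field_simps)
  qed
  also have "\<dots> \<le> (\<Sum>M\<in>(\<lambda>(A,B). A + B) ` (W k \<times> W (n - k)). ?g M)"
  proof (rule sum_mono2)
    show "?X \<subseteq> (\<lambda>(A,B). A + B) ` (W k \<times> W (n - k))"
    proof
      fix M assume "M \<in> ?X"
      then obtain A where A: "M \<in> W n" "A \<subseteq># M" "wt A = k" by blast
      hence "A \<in> W k" by (auto simp: W_def dest: mset_subset_eqD)
      moreover have "M - A \<in> W (n - k)" using A by (auto simp: W_def wt_diff dest: in_diffD)
      moreover have "M = A + (M - A)" using A by simp
      ultimately show "M \<in> (\<lambda>(A,B). A + B) ` (W k \<times> W (n - k))" by force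
    qed
  qed auto
  also have "\<dots> \<le> (\<Sum>x\<in>W k \<times> W (n - k). (?g \<circ> (\<lambda>(A,B). A + B)) x)"
    by (rule sum_image_le) auto
  also have "\<dots> = (\<Sum>A\<in>W k. \<Sum>B\<in>W (n - k). 2 powr t * (1 / 2) ^ small k A * (1 / 2) ^ small k B)"
    by (subst sum.cartesian_product) (simp add: case_prod_unfold power_add mult.assoc)
  also have "\<dots> = 2 powr t * (S ?w k * S ?w (n - k))"
    unfolding S_def prod_halfw sum_product by (simp only: sum_distrib_left mult.assoc)
  also have "S ?w k * S ?w (n - k) = (half_avg k k * half_avg k (n - k)) * real q ^ n"
    using k q_ge_2 by (simp add: half_avg_def field_simps flip: power_add)
  also have "2 powr t * \<dots> \<le> 2 powr t * ((1 / real k) * real q ^ n)"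
  proof (intro mult_left_mono mult_right_mono)
    have "half_avg k k * half_avg k (n - k) \<le> cbin k * (2 * cbin k)"
      using k by (intro mult_mono half_avg_le half_avg_ge half_avg_nonneg) (auto intro: less_imp_le[OF cbin_pos])
    also have "\<dots> = 2 * cbin k ^ 2" by (simp add: power2_eq_square)
    also have "\<dots> \<le> 2 * (1 / sqrt (2 * real k + 1)) ^ 2"
      using cbin_pos[of k] cbin_le[of k] by (intro mult_left_mono power_mono) auto
    also have "\<dots> \<le> 1 / real k" using k by (simp add: power_divide field_simps)
    finally show "half_avg k k * half_avg k (n - k) \<le> 1 / real k" .
  qed auto
  finally show ?thesis by simp
qed

text \<open>The primes themselves, the pairs with j = 1, contribute d times their number to
  \<open>mangoldt_sum_one\<close>.\<close>

lemma card_deg_le: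
  assumes "d \<ge> 1"
  shows "real (card {P \<in> Pr. dg P = d}) \<le> real q ^ d / real d"
proof -
  have "real d * real (card {P \<in> Pr. dg P = d}) = (\<Sum>(P,j)\<in>{P \<in> Pr. dg P = d} \<times> {1::nat}. real (dg P) * 1 ^ j)"
    by (subst sum.cartesian_product[symmetric]) simp
  also have "\<dots> \<le> mangoldt_sum (\<lambda>_. 1) d"
    unfolding mangoldt_sum_def by (intro sum_mono2 finite_powers) (auto simp: powers_def)
  also have "\<dots> = real q ^ d" using assms by (rule mangoldt_sum_one)
  finally show ?thesis using assms by (simp add: field_simps)
qed

end

section \<open>Exponential moments of the number of small primes\<close>

context
  fixes z :: real
  assumes z: "1 < z" "z \<le> 3 / 2"
begin

text \<open>
  Chosen such that \<open>z ^ v\<close> is a sum of \<open>pcoef j\<close> over the \<open>j \<le> v\<close>: the moment \<open>z ^ small K M\<close> then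
  expands over the sub-multisets of \<open>M\<close>.
\<close>

definition pcoef :: "nat \<Rightarrow> real" where
  "pcoef j = (if j = 0 then 1 else (z - 1) * z ^ (j - 1))"

lemma pcoef_nonneg: "pcoef j \<ge> 0"
  using z by (auto simp: pcoef_def)

lemma sum_pcoef: "(\<Sum>j\<le>v. pcoef j) = z ^ v"
proof (induction v)
  case (Suc v)
  thus ?case by (simp add: pcoef_def algebra_simps)
qed (simp add: pcoef_def)

text \<open>At u = 1 / q ^ \<open>dg P\<close> this bounds the local factor of P in the moment.
  Apart from the term 1 the series is geometric with ratio z * u <= 3/4.\<close>

lemma sum_pcoef_power_le:
  assumes "0 \<le> u" "u \<le> 1 / 2"
  shows "(\<Sum>j\<le>n. pcoef j * u ^ j) \<le> exp ((z - 1) * (u + 6 * u\<^sup>2))"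
proof -
  have zu: "z * u \<le> 3 / 4" using mult_mono[of z "3/2" u "1/2"] z assms by simp
  have "(\<Sum>j\<le>n. pcoef j * u ^ j) \<le> (\<Sum>j\<le>Suc n. pcoef j * u ^ j)"
    using assms pcoef_nonneg by simp
  also have "\<dots> = 1 + (\<Sum>j\<le>n. pcoef (Suc j) * u ^ Suc j)"
    by (subst sum.atMost_Suc_shift) (simp add: pcoef_def)
  also have "(\<Sum>j\<le>n. pcoef (Suc j) * u ^ Suc j) = (z - 1) * u * (\<Sum>j\<le>n. (z * u) ^ j)"
    by (simp add: pcoef_def sum_distrib_left power_mult_distrib mult_ac)
  also have "(\<Sum>j\<le>n. (z * u) ^ j) \<le> 1 / (1 - z * u)"
  proof -
    have "(\<Sum>j\<le>n. (z * u) ^ j) = (1 - (z * u) ^ Suc n) / (1 - z * u)"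
      using zu by (subst sum_gp0) auto
    also have "\<dots> \<le> 1 / (1 - z * u)" using zu assms z by (intro divide_right_mono) auto
    finally show ?thesis .
  qed
  \<comment> \<open>On [0, 3/4] one has 1 / (1 - x) <= 1 + 4 x, because x * (3 - 4 x) >= 0; with z
    <= 3/2 this yields the coefficient 6.\<close>
  also have "1 / (1 - z * u) \<le> 1 + 4 * (z * u)"
  proof -
    have "0 \<le> (z * u) * (3 - 4 * (z * u))" using zu assms z by (intro mult_nonneg_nonneg) auto
    thus ?thesis using zu by (simp add: divide_simps algebra_simps)
  qed
  also have "1 + 4 * (z * u) \<le> 1 + 6 * u" using z assms mult_right_mono[of z "3/2" u] by linarith
  finally have "(\<Sum>j\<le>n. pcoef j * u ^ j) \<le> 1 + (z - 1) * u * (1 + 6 * u)"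
    using z assms by (simp add: mult_left_mono)
  also have "\<dots> = 1 + (z - 1) * (u + 6 * u\<^sup>2)" by (simp add: power2_eq_square algebra_simps)
  also have "\<dots> \<le> exp ((z - 1) * (u + 6 * u\<^sup>2))" by (rule exp_ge_add_one_self)
  finally show ?thesis .
qed

end

context prime_system
begin

text \<open>A Mertens-type sum. By \<open>card_deg_le\<close> the primes of degree d contribute at
  most 1 / d to the linear part; their quadratic part is at most 6 * (1/2) ^ d and sums to at most
  6.\<close>

lemma sum_over_small_primes:
  "(\<Sum>P | P \<in> Pr \<and> dg P \<le> K. 1 / real q ^ dg P + 6 * (1 / real q ^ dg P)\<^sup>2) \<le> harm K + 6"
proof -
  have q: "real q \<ge> 2" using q_ge_2 by simp
  have "{P \<in> Pr. dg P \<le> K} = (\<Union>d\<in>{1..K}. {P \<in> Pr. dg P = d})"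
    using dg_pos by (auto simp: Suc_le_eq)
  hence "(\<Sum>P | P \<in> Pr \<and> dg P \<le> K. 1 / real q ^ dg P + 6 * (1 / real q ^ dg P)\<^sup>2) =
     (\<Sum>d=1..K. \<Sum>P | P \<in> Pr \<and> dg P = d. 1 / real q ^ dg P + 6 * (1 / real q ^ dg P)\<^sup>2)"
    using finite_deg by (simp only:) (subst sum.UNION_disjoint, auto)
  also have "\<dots> = (\<Sum>d=1..K. real (card {P \<in> Pr. dg P = d}) * (1 / real q ^ d + 6 * (1 / real q ^ d)\<^sup>2))"
    by simp
  also have "\<dots> \<le> (\<Sum>d=1..K. 1 / real d + 6 * (1 / 2) ^ d)"
  proof (intro sum_mono)
    fix d assume d: "d \<in> {1..K}"
    have "real (card {P \<in> Pr. dg P = d}) * (1 / real q ^ d + 6 * (1 / real q ^ d)\<^sup>2) \<le>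
       real q ^ d / real d * (1 / real q ^ d + 6 * (1 / real q ^ d)\<^sup>2)"
      using d card_deg_le[of d] by (intro mult_right_mono) auto
    also have "\<dots> = 1 / real d + 6 * ((1 / real d) * (1 / real q) ^ d)"
      using q by (simp add: divide_simps power2_eq_square)
    also have "(1 / real d) * (1 / real q) ^ d \<le> 1 * (1 / 2) ^ d"
      using q d by (intro mult_mono power_mono) (auto simp: field_simps)
    finally show "real (card {P \<in> Pr. dg P = d}) * (1 / real q ^ d + 6 * (1 / real q ^ d)\<^sup>2) \<le>
       1 / real d + 6 * (1 / 2) ^ d" by simp
  qed
  also have "\<dots> = harm K + 6 * (\<Sum>d=1..K. (1 / 2) ^ d)"
    by (simp add: harm_def sum.distrib sum_distrib_left inverse_eq_divide)
  also have "(\<Sum>d=1..K. (1 / 2 :: real) ^ d) = 1 - (1 / 2) ^ K"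
    by (induction K) auto
  also have "\<dots> \<le> 1" by simp
  finally show ?thesis by simp
qed

text \<open>Expand z ^ \<open>small K M\<close> over the multisets \<open>A g\<close> contained in M
  and exchange the sums. Since \<open>A g\<close> lies in at most q ^ n / q ^
  \<open>wt (A g)\<close> of the M, the total is bounded by a product of local factors, as if the
  multiplicities were independent.\<close>

lemma sum_power_small_le:
  assumes z: "1 < z" "z \<le> 3 / 2"
  shows "(\<Sum>M\<in>W n. z ^ small K M) \<le> exp ((z - 1) * (harm K + 6)) * real q ^ n"
proof -
  define Q where "Q = {P \<in> Pr. dg P \<le> K}"
  have fin: "finite Q" unfolding Q_def by (rule finite_deg_le)
  \<comment> \<open>No multiplicity in a multiset of weight n exceeds n, so exponents up to n
    suffice.\<close>
  define G where "G = PiE Q (\<lambda>_. {..n})"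
  have finG: "finite G" unfolding G_def using fin by (intro finite_PiE) auto
  define A where "A g = (\<Sum>P\<in>Q. replicate_mset (g P) P)" for g :: "'a \<Rightarrow> nat"
  have wtA: "wt (A g) = (\<Sum>P\<in>Q. g P * dg P)" for g
    unfolding A_def using fin by (induction Q rule: finite_induct) auto
  have countA: "count (A g) P = (if P \<in> Q then g P else 0)" for g P
    using fin by (auto simp: A_def count_sum if_distrib cong: if_cong)
  have setA: "set_mset (A g) \<subseteq> Pr" for g
    using countA[of g] by (auto simp: Q_def simp flip: count_greater_zero_iff split: if_splits)
  have subA: "A g \<subseteq># M \<longleftrightarrow> (\<forall>P\<in>Q. g P \<le> count M P)" for g M
    by (auto simp: subseteq_mset_def countA)
  have expand: "z ^ small K M = (\<Sum>g\<in>G. if A g \<subseteq># M then (\<Prod>P\<in>Q. pcoef z (g P)) else 0)"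
    if M: "M \<in> W n" for M
  proof -
    have setM: "set_mset M \<subseteq> Pr" using M by (simp add: W_def)
    have le: "count M P \<le> n" for P
    proof (cases "P \<in># M")
      case True
      have "replicate_mset (count M P) P \<subseteq># M" by (simp flip: count_le_replicate_mset_subset_eq)
      hence "count M P * dg P \<le> n" using wt_mono M by (fastforce simp: W_def)
      moreover have "dg P > 0" using True M dg_pos by (auto simp: W_def)
      ultimately show ?thesis using mult_le_mono2[of 1 "dg P" "count M P"] by linarith
    qed (simp add: not_in_iff)
    have "small K M = (\<Sum>P\<in>Q. count M P)"
      using setM unfolding small_def
    proof (induction M)
      case (add P M)
      have "(\<Sum>R\<in>Q. count (add_mset P M) R) = (\<Sum>R\<in>Q. count M R + (if R = P then 1 else 0))"
        by (intro sum.cong) auto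
      thus ?case using add fin by (simp add: sum.distrib Q_def)
    qed simp
    hence "z ^ small K M = (\<Prod>P\<in>Q. z ^ count M P)" by (simp add: power_sum)
    also have "\<dots> = (\<Prod>P\<in>Q. \<Sum>j\<le>n. if j \<le> count M P then pcoef z j else 0)"
    proof (intro prod.cong refl)
      fix P
      have "z ^ count M P = (\<Sum>j\<in>{j\<in>{..n}. j \<le> count M P}. pcoef z j)"
        using le[of P] by (subst sum_pcoef[OF z, symmetric], intro sum.cong) auto
      thus "z ^ count M P = (\<Sum>j\<le>n. if j \<le> count M P then pcoef z j else 0)"
        by (subst (asm) sum.inter_filter) auto
    qed
    also have "\<dots> = (\<Sum>g\<in>G. \<Prod>P\<in>Q. if g P \<le> count M P then pcoef z (g P) else 0)"
      unfolding G_def by (rule prod_sum_PiE) (use fin in auto)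
    also have "\<dots> = (\<Sum>g\<in>G. if A g \<subseteq># M then (\<Prod>P\<in>Q. pcoef z (g P)) else 0)"
    proof (intro sum.cong refl)
      fix g
      show "(\<Prod>P\<in>Q. if g P \<le> count M P then pcoef z (g P) else 0) =
        (if A g \<subseteq># M then (\<Prod>P\<in>Q. pcoef z (g P)) else 0)"
        using fin by (auto simp: subA intro: prod.cong)
    qed
    finally show ?thesis .
  qed
  have nn: "(\<Prod>P\<in>Q. pcoef z (g P)) \<ge> 0" for g
    by (intro prod_nonneg) (use pcoef_nonneg[OF z] in auto)
  have "(\<Sum>M\<in>W n. z ^ small K M) = (\<Sum>g\<in>G. \<Sum>M\<in>W n. if A g \<subseteq># M then (\<Prod>P\<in>Q. pcoef z (g P)) else 0)"
    by (subst sum.swap) (use expand in \<open>auto intro: sum.cong\<close>)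
  also have "\<dots> = (\<Sum>g\<in>G. (\<Prod>P\<in>Q. pcoef z (g P)) * real (card {M \<in> W n. A g \<subseteq># M}))"
    by (intro sum.cong refl) (simp add: mult.commute flip: sum.inter_filter)
  also have "\<dots> \<le> (\<Sum>g\<in>G. (\<Prod>P\<in>Q. pcoef z (g P)) * (real q ^ n / real q ^ wt (A g)))"
    by (intro sum_mono mult_left_mono card_superset_le setA nn)
  also have "\<dots> = (\<Sum>g\<in>G. (\<Prod>P\<in>Q. pcoef z (g P) * (1 / real q ^ dg P) ^ g P)) * real q ^ n"
    unfolding sum_distrib_right
  proof (intro sum.cong refl)
    fix g
    have "1 / real q ^ wt (A g) = (\<Prod>P\<in>Q. (1 / real q ^ dg P) ^ g P)"
    proof -
      have "1 / real q ^ wt (A g) = (1 / real q) ^ (\<Sum>P\<in>Q. dg P * g P)"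
        by (simp add: wtA power_one_over mult.commute)
      also have "\<dots> = (\<Prod>P\<in>Q. ((1 / real q) ^ dg P) ^ g P)"
        by (simp only: power_sum power_mult)
      finally show ?thesis by (simp only: power_one_over)
    qed
    thus "(\<Prod>P\<in>Q. pcoef z (g P)) * (real q ^ n / real q ^ wt (A g)) =
       (\<Prod>P\<in>Q. pcoef z (g P) * (1 / real q ^ dg P) ^ g P) * real q ^ n"
      by (simp add: prod.distrib divide_inverse)
  qed
  also have "(\<Sum>g\<in>G. (\<Prod>P\<in>Q. pcoef z (g P) * (1 / real q ^ dg P) ^ g P)) =
     (\<Prod>P\<in>Q. \<Sum>j\<le>n. pcoef z j * (1 / real q ^ dg P) ^ j)"
    unfolding G_def by (rule prod_sum_PiE[symmetric]) (use fin in auto)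
  also have "\<dots> \<le> (\<Prod>P\<in>Q. exp ((z - 1) * (1 / real q ^ dg P + 6 * (1 / real q ^ dg P)\<^sup>2)))"
  proof (intro prod_mono conjI sum_nonneg mult_nonneg_nonneg pcoef_nonneg[OF z] sum_pcoef_power_le[OF z])
    fix P assume "P \<in> Q"
    hence "dg P \<ge> 1" using dg_pos by (auto simp: Q_def Suc_le_eq)
    hence "real q ^ 1 \<le> real q ^ dg P" using q_ge_2 by (intro power_increasing) auto
    moreover have "real q \<ge> 2" using q_ge_2 by simp
    ultimately have "2 \<le> real q ^ dg P" by (simp only: power_one_right)
    thus "1 / real q ^ dg P \<le> 1 / 2" using q_ge_2 by (intro divide_left_mono) auto
  qed auto
  also have "\<dots> = exp ((z - 1) * (\<Sum>P\<in>Q. 1 / real q ^ dg P + 6 * (1 / real q ^ dg P)\<^sup>2))"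
    using fin by (simp add: exp_sum sum_distrib_left)
  also have "\<dots> \<le> exp ((z - 1) * (harm K + 6))"
    using z sum_over_small_primes[of K] unfolding Q_def by (simp add: mult_left_mono)
  finally show ?thesis by (simp add: mult_right_mono)
qed

lemma card_small_gt_le:
  assumes z: "1 < z" "z \<le> 3 / 2"
  shows "real (card {M \<in> W n. real (small K M) > t}) \<le> exp ((z - 1) * (harm K + 6)) / z powr t * real q ^ n"
proof -
  have "real (card {M \<in> W n. real (small K M) > t}) * z powr t = (\<Sum>M | M \<in> W n \<and> real (small K M) > t. z powr t)"
    by simp
  also have "\<dots> \<le> (\<Sum>M | M \<in> W n \<and> real (small K M) > t. z ^ small K M)"
  proof (intro sum_mono)
    fix M assume "M \<in> {M. M \<in> W n \<and> real (small K M) > t}"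
    hence "z powr t \<le> z powr real (small K M)" using z by (intro powr_mono) auto
    thus "z powr t \<le> z ^ small K M" using z by (subst (asm) powr_realpow) auto
  qed
  also have "\<dots> \<le> (\<Sum>M\<in>W n. z ^ small K M)"
    using z by (intro sum_mono2) auto
  also have "\<dots> \<le> exp ((z - 1) * (harm K + 6)) * real q ^ n" by (rule sum_power_small_le[OF z])
  finally show ?thesis using z by (simp add: field_simps)
qed

section \<open>Typical multisets: few small primes at every large scale\<close>

lemma small_mono: "K \<le> K' \<Longrightarrow> small K M \<le> small K' M"
  by (induction M) (auto simp: small_def)

text \<open>
  The constant \<open>37 / 50\<close> must exceed \<open>ln 2\<close>, so that a random multiset is good with high probability,
  and be less than \<open>3 / 4\<close>, so that the fourth power of \<open>k powr (37 / 50 - 1)\<close> is summable.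
\<close>

definition good :: "nat \<Rightarrow> 'a multiset \<Rightarrow> bool" where
  "good i0 M \<longleftrightarrow> (\<forall>i\<ge>i0. real (small (2 ^ i) M) \<le> 37 / 50 * real i)"

end

text \<open>With z = 103/100, \<open>card_small_gt_le\<close> at K = 2 ^ i and t = 37/50 * i decays
  like the i-th power of this ratio: (z - 1) * ln 2 comes from the harmonic sum, 37/50 * ln z from z
  powr t. As 37/50 > ln 2, any z close enough to 1 makes the exponent negative.\<close>

definition tail_ratio :: real where
  "tail_ratio = exp (3 / 100 * ln 2 - 37 / 50 * ln (103 / 100))"

lemma tail_ratio_less_1: "tail_ratio < 1"
proof -
  \<comment> \<open>The bound ln x <= x - 1 at x = 100/103 gives ln (103/100) >= 3/103, and 3/100 *
    25/36 < 37/50 * 3/103.\<close>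
  have "ln (100 / 103 :: real) \<le> 100 / 103 - 1" by (rule ln_le_minus_one) simp
  moreover have "ln (100 / 103 :: real) = - ln (103 / 100)" using ln_inverse[of "103/100 :: real"] by simp
  ultimately have "ln (103 / 100 :: real) \<ge> 3 / 103" by simp
  thus ?thesis using ln2_le_25_over_36 by (simp add: tail_ratio_def)
qed

text \<open>The difference \<open>harm m - ln m\<close> decreases in m and equals 1 at m =
  1.\<close>

lemma harm_power_2_le: "harm (2 ^ i) \<le> 1 + real i * ln 2"
proof -
  have "harm (Suc (2 ^ i - 1)) - ln (real (Suc (2 ^ i - 1))) \<le> harm (Suc 0) - ln (real (Suc 0))"
    using decseq_harm_diff_ln by (rule decseqD) simp
  thus ?thesis by (simp add: harm_def ln_realpow)
qed

context prime_system
begin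

text \<open>A union bound over the scales 2 ^ i, dominated by a geometric series. It is a finite
  one: all degrees are positive, so M has at most n elements and only scales i < 2 * n can
  fail.\<close>

lemma card_not_good_le:
  "real (card {M \<in> W n. \<not> good i0 M}) \<le> exp (21 / 100) * tail_ratio ^ i0 / (1 - tail_ratio) * real q ^ n"
proof -
  have r: "0 < tail_ratio" "tail_ratio < 1" using tail_ratio_less_1 by (auto simp: tail_ratio_def)
  have "size M \<le> wt M" if "set_mset M \<subseteq> Pr" for M
    using that
  proof (induction M)
    case (add P M)
    thus ?case using dg_pos[of P] by (simp add: wt_def)
  qed simp
  hence size: "size M \<le> n" if "M \<in> W n" for M using that by (auto simp: W_def)
  have "{M \<in> W n. \<not> good i0 M} \<subseteq> (\<Union>i\<in>{i0..<i0+2*n}. {M \<in> W n. real (small (2 ^ i) M) > 37 / 50 * real i})"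
  proof
    fix M assume "M \<in> {M \<in> W n. \<not> good i0 M}"
    then obtain i where i: "M \<in> W n" "i \<ge> i0" "real (small (2 ^ i) M) > 37 / 50 * real i"
      by (auto simp: good_def not_le)
    moreover have "small (2 ^ i) M \<le> n"
      using size[OF i(1)] size_filter_mset_lesseq[of _ M] unfolding small_def by (rule order_trans[rotated])
    hence "i < 2 * n" using i(3) by linarith
    ultimately show "M \<in> (\<Union>i\<in>{i0..<i0+2*n}. {M \<in> W n. real (small (2 ^ i) M) > 37 / 50 * real i})"
      by auto
  qed
  hence "card {M \<in> W n. \<not> good i0 M} \<le> card (\<Union>i\<in>{i0..<i0+2*n}. {M \<in> W n. real (small (2 ^ i) M) > 37 / 50 * real i})"
    by (intro card_mono) auto
  also have "\<dots> \<le> (\<Sum>i=i0..<i0+2*n. card {M \<in> W n. real (small (2 ^ i) M) > 37 / 50 * real i})"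
    by (intro card_UN_le) auto
  finally have "real (card {M \<in> W n. \<not> good i0 M}) \<le> (\<Sum>i=i0..<i0+2*n. real (card {M \<in> W n. real (small (2 ^ i) M) > 37 / 50 * real i}))"
    by (simp flip: of_nat_sum)
  also have "\<dots> \<le> (\<Sum>i=i0..<i0+2*n. exp (21 / 100) * tail_ratio ^ i * real q ^ n)"
  proof (intro sum_mono)
    fix i
    have "real (card {M \<in> W n. real (small (2 ^ i) M) > 37 / 50 * real i}) \<le>
        exp ((103 / 100 - 1) * (harm (2 ^ i) + 6)) / (103 / 100) powr (37 / 50 * real i) * real q ^ n"
      by (rule card_small_gt_le) auto
    also have "exp ((103 / 100 - 1) * (harm (2 ^ i) + 6)) / (103 / 100) powr (37 / 50 * real i) =
       exp (3 / 100 * (harm (2 ^ i) + 6) - 37 / 50 * real i * ln (103 / 100))"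
      by (simp add: powr_def exp_diff)
    \<comment> \<open>The constant is 3/100 * (1 + 6), with 1 from the harmonic sum and 6 from the
      moment bound.\<close>
    also have "\<dots> \<le> exp (21 / 100 + real i * (3 / 100 * ln 2 - 37 / 50 * ln (103 / 100)))"
      using harm_power_2_le[of i] by (simp add: algebra_simps)
    also have "\<dots> = exp (21 / 100) * tail_ratio ^ i"
      by (simp add: exp_add tail_ratio_def exp_of_nat_mult)
    finally show "real (card {M \<in> W n. real (small (2 ^ i) M) > 37 / 50 * real i}) \<le>
       exp (21 / 100) * tail_ratio ^ i * real q ^ n" by (simp add: mult_right_mono)
  qed
  also have "\<dots> = exp (21 / 100) * (\<Sum>i=i0..<i0+2*n. tail_ratio ^ i) * real q ^ n"
    by (simp add: sum_distrib_left sum_distrib_right)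
  also have "(\<Sum>i=i0..<i0+2*n. tail_ratio ^ i) = tail_ratio ^ i0 * (\<Sum>i<2*n. tail_ratio ^ i)"
    unfolding sum_distrib_left
    by (rule sum.reindex_bij_witness[where i = "\<lambda>i. i + i0" and j = "\<lambda>i. i - i0"]) (auto simp flip: power_add)
  also have "(\<Sum>i<2*n. tail_ratio ^ i) = (1 - tail_ratio ^ (2 * n)) / (1 - tail_ratio)"
    using r by (simp add: sum_gp_strict)
  also have "\<dots> \<le> 1 / (1 - tail_ratio)" using r by (intro divide_right_mono) auto
  finally show ?thesis using r by (simp add: mult_left_mono mult_right_mono)
qed

text \<open>\<open>good\<close> controls powers of 2 only, so \<open>small k\<close> is bounded at
  the next power above k, which costs a factor 2 powr (37/50) <= 2. The exponent is 37/50 -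
  1.\<close>

lemma card_good_divisor_le:
  assumes k: "k \<ge> 2 ^ i0" "2 * k \<le> n"
  shows "real (card {M \<in> W n. good i0 M \<and> (\<exists>A. A \<subseteq># M \<and> wt A = k)}) \<le> 2 * real k powr (-13/50) * real q ^ n"
proof -
  have k1: "k \<ge> 1" using k(1) by (metis le_trans one_le_numeral one_le_power)
  obtain i where i: "2 ^ i \<le> k" "k < 2 ^ (i + 1)" using ex_power_ivl1[of 2 k] k1 by auto
  have "2 ^ i0 < (2::nat) ^ (i + 1)" using k(1) i(2) by linarith
  hence i0: "i0 \<le> i + 1" by (intro less_imp_le) (rule power_less_imp_less_exp[rotated], auto)
  let ?t = "37 / 50 * (real i + 1)"
  have "real (card {M \<in> W n. good i0 M \<and> (\<exists>A. A \<subseteq># M \<and> wt A = k)}) \<le>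
      real (card {M \<in> W n. (\<exists>A. A \<subseteq># M \<and> wt A = k) \<and> real (small k M) \<le> ?t})"
  proof (intro of_nat_mono card_mono subsetI)
    fix M assume M: "M \<in> {M \<in> W n. good i0 M \<and> (\<exists>A. A \<subseteq># M \<and> wt A = k)}"
    have "real (small k M) \<le> real (small (2 ^ (i + 1)) M)"
      using small_mono[of k "2 ^ (i + 1)" M] i by simp
    also have "\<dots> \<le> 37 / 50 * real (i + 1)" using M i0 unfolding good_def by blast
    finally show "M \<in> {M \<in> W n. (\<exists>A. A \<subseteq># M \<and> wt A = k) \<and> real (small k M) \<le> ?t}"
      using M by (simp add: add.commute)
  qed auto
  also have "\<dots> \<le> 2 powr ?t / real k * real q ^ n"
    by (rule card_divisor_le) (use k k1 in auto)
  also have "2 powr ?t / real k \<le> 2 * real k powr (-13/50)"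
  proof -
    have "2 powr ?t = (2 powr real (i + 1)) powr (37/50)" by (simp add: powr_powr mult.commute add.commute)
    also have "2 powr real (i + 1) = 2 * 2 ^ i" by (subst powr_realpow) auto
    also have "(2 * 2 ^ i) powr (37/50) \<le> (2 * real k) powr (37/50)"
    proof (intro powr_mono2)
      have "real (2 ^ i) \<le> real k" using i by (intro of_nat_mono)
      thus "2 * 2 ^ i \<le> 2 * real k" by simp
    qed auto
    also have "\<dots> = 2 powr (37/50) * real k powr (37/50)" by (simp add: powr_mult)
    also have "\<dots> \<le> 2 powr 1 * real k powr (37/50)" by (intro mult_right_mono powr_mono) auto
    finally have "2 powr ?t / real k \<le> 2 * (real k powr (37/50) / real k powr 1)"
      using k1 by (simp add: divide_right_mono)
    also have "real k powr (37/50) / real k powr 1 = real k powr (-13/50)"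
      by (subst powr_diff[symmetric]) simp
    finally show ?thesis .
  qed
  finally show ?thesis by (simp add: mult_right_mono)
qed

end

section \<open>Factorization patterns of polynomials over prime fields\<close>

text \<open>The shape of \<open>monic_poly\<close> over any ring; it serves over the integers, the
  residue fields and the complex numbers.\<close>

definition mpoly :: "nat \<Rightarrow> (nat \<Rightarrow> 'b) \<Rightarrow> 'b::comm_ring_1 poly" where
  "mpoly n c = monom 1 n + (\<Sum>i<n. monom (c i) i)"

lemma coeff_mpoly: "coeff (mpoly n c) i = (if i < n then c i else if i = n then 1 else 0)"
  by (auto simp: mpoly_def coeff_sum)

lemma degree_mpoly [simp]: "degree (mpoly n c) = n"
proof (rule antisym)
  show "degree (mpoly n c) \<le> n" by (intro degree_le) (auto simp: coeff_mpoly)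
  show "n \<le> degree (mpoly n c)" by (intro le_degree) (auto simp: coeff_mpoly)
qed

lemma lead_coeff_mpoly [simp]: "lead_coeff (mpoly n c) = 1"
  by (simp add: coeff_mpoly)

lemma bij_betw_mpoly:
  "bij_betw (mpoly n) (PiE {..<n} (\<lambda>_. A)) {f. lead_coeff f = 1 \<and> degree f = n \<and> (\<forall>i<n. coeff f i \<in> A)}"
proof (rule bij_betwI[where g = "\<lambda>f. restrict (coeff f) {..<n}"])
  show "mpoly n \<in> PiE {..<n} (\<lambda>_. A) \<rightarrow> {f. lead_coeff f = 1 \<and> degree f = n \<and> (\<forall>i<n. coeff f i \<in> A)}"
  proof
    fix c assume "c \<in> PiE {..<n} (\<lambda>_. A)"
    hence "\<forall>i<n. c i \<in> A" by blast
    thus "mpoly n c \<in> {f. lead_coeff f = 1 \<and> degree f = n \<and> (\<forall>i<n. coeff f i \<in> A)}"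
      by (simp add: coeff_mpoly)
  qed
  show "restrict (coeff (mpoly n c)) {..<n} = c" if c: "c \<in> PiE {..<n} (\<lambda>_. A)" for c
  proof
    fix i show "restrict (coeff (mpoly n c)) {..<n} i = c i"
      using PiE_arb[OF c, of i] by (simp add: coeff_mpoly)
  qed
  show "mpoly n (restrict (coeff f) {..<n}) = f"
    if "f \<in> {f. lead_coeff f = 1 \<and> degree f = n \<and> (\<forall>i<n. coeff f i \<in> A)}" for f
  proof (rule poly_eqI)
    fix i show "coeff (mpoly n (restrict (coeff f) {..<n})) i = coeff f i"
      using that coeff_eq_0[of f i] by (cases i n rule: linorder_cases) (auto simp: coeff_mpoly)
  qed
qed simp

text \<open>Unique factorization modulo p, phrased over \<open>int poly\<close> so that p stays a
  variable and no type of size p occurs. \<Phi> f is the factorization of the reduction of f, with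
  irreducibles lifted to integer polynomials; injectivity on residue tuples transfers counts of
  multisets to counts of tuples.\<close>

definition fp_model :: "nat \<Rightarrow> bool" where
  "fp_model p \<longleftrightarrow> (\<exists>(Pr :: int poly set) \<Phi>. prime_system Pr degree p \<and>
     (\<forall>f. lead_coeff f = 1 \<longrightarrow> set_mset (\<Phi> f) \<subseteq> Pr \<and> (\<Sum>P\<in>#\<Phi> f. degree P) = degree f) \<and>
     (\<forall>f g. lead_coeff f = 1 \<longrightarrow> lead_coeff g = 1 \<longrightarrow> \<Phi> (f * g) = \<Phi> f + \<Phi> g) \<and>
     (\<forall>f g. (\<forall>i. coeff f i mod int p = coeff g i mod int p) \<longrightarrow> \<Phi> f = \<Phi> g) \<and>
     (\<forall>n. inj_on (\<Phi> \<circ> mpoly n) (PiE {..<n} (\<lambda>_. {0..<int p}))))"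

lemma degree_prod_mset:
  "0 \<notin># A \<Longrightarrow> degree (prod_mset A) = (\<Sum>P\<in>#A. degree (P :: 'b :: idom poly))"
  by (induction A) (auto simp: degree_mult_eq)

lemma lead_coeff_prod_mset:
  "(\<And>P. P \<in># A \<Longrightarrow> lead_coeff P = 1) \<Longrightarrow> lead_coeff (prod_mset A) = (1 :: 'b :: idom)"
  by (induction A) (auto simp: lead_coeff_mult)

lemma of_int_mod_ring_eq_iff:
  "(of_int a :: 'a :: prime_card mod_ring) = of_int b \<longleftrightarrow> a mod int CARD('a) = b mod int CARD('a)"
  unfolding of_int_of_int_mod_ring by transfer auto

text \<open>\<open>prime\<close> includes being normalized, and over a field the unit factor of a
  polynomial is its leading coefficient.\<close>

lemma lead_coeff_prime_mod_ring:
  "prime (P :: 'a :: prime_card mod_ring poly) \<Longrightarrow> lead_coeff P = 1"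
proof -
  assume P: "prime P"
  hence "unit_factor P = 1" by (metis not_prime_0 normalize_prime unit_factor_normalize)
  hence "coeff (unit_factor P) 0 = 1" by simp
  thus "lead_coeff P = 1" by (simp add: unit_factor_poly_def unit_factor_mod_ring_def)
qed

lemma normalize_monic_mod_ring:
  "lead_coeff (f :: 'a :: prime_card mod_ring poly) = 1 \<Longrightarrow> normalize f = f"
  by (simp add: normalize_poly_def)

text \<open>\<open>emb\<close> lifts residues to their least nonnegative representatives. Unique
  factorization makes \<open>fac\<close> a bijection from the monic polynomials of degree n to the
  multisets of weight n, so counting the former counts the latter.\<close>

lemma fp_model_CARD: "fp_model CARD('a :: prime_card)"
proof -
  let ?p = "CARD('a)"
  define red where "red = (map_poly of_int :: int poly \<Rightarrow> 'a mod_ring poly)"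
  define emb where "emb = (map_poly to_int_mod_ring :: 'a mod_ring poly \<Rightarrow> int poly)"
  define fac where "fac f = image_mset emb (prime_factorization f)" for f
  define Pr where "Pr = emb ` {P. prime P}"
  let ?M = "\<lambda>n. {f :: 'a mod_ring poly. lead_coeff f = 1 \<and> degree f = n}"
  have inj_emb: "inj emb"
    unfolding emb_def by (intro injI poly_eqI) (metis coeff_map_poly to_int_mod_ring_hom.hom_zero to_int_mod_ring_hom.injectivity)
  have degree_emb: "degree (emb f) = degree f" for f
    unfolding emb_def by (rule degree_map_poly) auto
  have prod_fac: "prod_mset (prime_factorization f) = f" if "lead_coeff f = 1" for f :: "'a mod_ring poly"
    using that normalize_monic_mod_ring[OF that] by (subst prod_mset_prime_factorization) auto
  have fac_inj: "f = g" if "lead_coeff f = 1" "lead_coeff g = 1" "fac f = fac g" for f g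
  proof -
    have "prime_factorization f = prime_factorization g"
      using that(3) multiset.inj_map[OF inj_emb] unfolding fac_def by (simp add: inj_eq)
    thus ?thesis using prod_fac that by metis
  qed
  have fac_W: "set_mset (fac f) \<subseteq> Pr \<and> (\<Sum>P\<in>#fac f. degree P) = degree f" if "lead_coeff f = 1" for f
  proof
    show "set_mset (fac f) \<subseteq> Pr" by (auto simp: fac_def Pr_def)
    have "0 \<notin># prime_factorization f" by (meson in_prime_factors_imp_prime not_prime_0)
    hence "degree f = (\<Sum>P\<in>#prime_factorization f. degree P)"
      using degree_prod_mset prod_fac[OF that] by metis
    thus "(\<Sum>P\<in>#fac f. degree P) = degree f" by (simp add: fac_def degree_emb image_mset.compositionality o_def)
  qed
  have bij: "bij_betw fac (?M n) {M. set_mset M \<subseteq> Pr \<and> (\<Sum>P\<in>#M. degree P) = n}" for n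
    unfolding bij_betw_def
  proof (intro conjI equalityI subsetI inj_onI)
    fix f g assume "f \<in> ?M n" "g \<in> ?M n" "fac f = fac g"
    thus "f = g" using fac_inj by blast
  next
    fix M assume "M \<in> fac ` ?M n"
    thus "M \<in> {M. set_mset M \<subseteq> Pr \<and> (\<Sum>P\<in>#M. degree P) = n}" using fac_W by blast
  next
    fix M assume M: "M \<in> {M. set_mset M \<subseteq> Pr \<and> (\<Sum>P\<in>#M. degree P) = n}"
    define A where "A = image_mset (inv_into UNIV emb) M"
    have MA: "M = image_mset emb A"
    proof -
      have "image_mset emb A = image_mset (\<lambda>x. x) M"
        unfolding A_def image_mset.compositionality
        by (intro image_mset_cong) (use M in \<open>auto simp: Pr_def f_inv_into_f\<close>)
      thus ?thesis by simp
    qed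
    have A: "prime P" if "P \<in># A" for P
      using that M inj_emb by (auto simp: A_def Pr_def inv_f_f)
    have facA: "fac (prod_mset A) = M"
      using A by (simp add: fac_def MA prime_factorization_prod_mset_primes)
    moreover have lc: "lead_coeff (prod_mset A) = 1"
      using A lead_coeff_prime_mod_ring by (intro lead_coeff_prod_mset) auto
    moreover have "degree (prod_mset A) = n" using fac_W[OF lc] facA M by auto
    ultimately show "M \<in> fac ` ?M n" by blast
  qed
  have card_M: "card (?M n) = ?p ^ n" for n
  proof -
    have "card (?M n) = card (PiE {..<n} (\<lambda>_. UNIV :: 'a mod_ring set))"
      using bij_betw_same_card[OF bij_betw_mpoly[of n "UNIV :: 'a mod_ring set"]] by simp
    thus ?thesis by (simp add: card_PiE)
  qed
  have coeff_red: "coeff (red f) i = of_int (coeff f i)" for f i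
    unfolding red_def by (simp add: coeff_map_poly)
  have red_mult: "red (f * g) = red f * red g" for f g
    unfolding red_def by (simp add: of_int_poly_hom.hom_mult)
  have red_monic: "lead_coeff (red f) = 1 \<and> degree (red f) = degree f" if "lead_coeff f = 1" for f
  proof -
    have "degree (red f) = degree f"
      using that by (intro antisym degree_le le_degree) (auto simp: coeff_red coeff_eq_0)
    thus ?thesis using that by (simp add: coeff_red)
  qed
  show ?thesis unfolding fp_model_def
  proof (intro exI[of _ Pr] exI[of _ "\<lambda>f. fac (red f)"] conjI allI impI)
    show "prime_system Pr degree ?p"
    proof
      fix P assume "P \<in> Pr"
      then obtain Q :: "'a mod_ring poly" where Q: "prime Q" "P = emb Q" by (auto simp: Pr_def)
      have "degree Q \<noteq> 0"
      proof
        assume "degree Q = 0"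
        hence "is_unit Q" using Q(1) by (metis is_unit_iff_degree not_prime_0)
        thus False using Q(1) not_prime_unit by blast
      qed
      thus "degree P > 0" using Q by (simp add: degree_emb)
    next
      show "?p \<ge> 2" using prime_card prime_ge_2_nat by blast
    next
      fix n show "card {M. set_mset M \<subseteq> Pr \<and> (\<Sum>P\<in>#M. degree P) = n} = ?p ^ n"
        using bij_betw_same_card[OF bij] card_M by simp
    qed
  next
    fix f :: "int poly" assume "lead_coeff f = 1"
    thus "set_mset (fac (red f)) \<subseteq> Pr" "(\<Sum>P\<in>#fac (red f). degree P) = degree f"
      using fac_W[of "red f"] red_monic[of f] by auto
  next
    fix f g :: "int poly" assume "lead_coeff f = 1" "lead_coeff g = 1"
    hence "red f \<noteq> 0" "red g \<noteq> 0" using red_monic by force+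
    thus "fac (red (f * g)) = fac (red f) + fac (red g)"
      by (simp add: fac_def red_mult prime_factorization_mult)
  next
    fix f g :: "int poly" assume "\<forall>i. coeff f i mod int ?p = coeff g i mod int ?p"
    hence "red f = red g" by (intro poly_eqI) (simp add: coeff_red of_int_mod_ring_eq_iff)
    thus "fac (red f) = fac (red g)" by simp
  next
    fix n show "inj_on ((\<lambda>f. fac (red f)) \<circ> mpoly n) (PiE {..<n} (\<lambda>_. {0..<int ?p}))"
    proof (rule inj_onI)
      fix c d assume c: "c \<in> PiE {..<n} (\<lambda>_. {0..<int ?p})" and d: "d \<in> PiE {..<n} (\<lambda>_. {0..<int ?p})"
        and eq: "((\<lambda>f. fac (red f)) \<circ> mpoly n) c = ((\<lambda>f. fac (red f)) \<circ> mpoly n) d"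
      have eq: "red (mpoly n c) = red (mpoly n d)"
      proof (rule fac_inj)
        show "lead_coeff (red (mpoly n c)) = 1" "lead_coeff (red (mpoly n d)) = 1"
          using red_monic[OF lead_coeff_mpoly] by blast+
      qed (use eq in simp)
      show "c = d"
      proof (rule PiE_ext[OF c d])
        fix i assume i: "i \<in> {..<n}"
        have "of_int (c i) = (of_int (d i) :: 'a mod_ring)"
          using arg_cong[OF eq, of "\<lambda>f. coeff f i"] i by (simp add: coeff_red coeff_mpoly)
        hence "c i mod int ?p = d i mod int ?p" by (simp add: of_int_mod_ring_eq_iff)
        thus "c i = d i" using c d i by (metis PiE_mem atLeastLessThan_iff mod_pos_pos_trivial)
      qed
    qed
  qed
qed

text \<open>
  The field with \<open>p\<close> elements needs a type with \<open>p\<close> elements, but a type cannot depend on the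
  variable \<open>p\<close>. It suffices to build it for one fixed prime, a counterexample to \<^const>\<open>fp_model\<close> if there is one.
\<close>

definition cex_prime :: nat where
  "cex_prime = (SOME p. prime p \<and> ((\<exists>p'. prime p' \<and> \<not> fp_model p') \<longrightarrow> \<not> fp_model p))"

lemma cex_prime: "prime cex_prime" "\<exists>p. prime p \<and> \<not> fp_model p \<Longrightarrow> \<not> fp_model cex_prime"
proof -
  have "\<exists>p::nat. prime p \<and> ((\<exists>p'. prime p' \<and> \<not> fp_model p') \<longrightarrow> \<not> fp_model p)"
    using two_is_prime_nat by blast
  from someI_ex[OF this]
  show "prime cex_prime" "\<exists>p. prime p \<and> \<not> fp_model p \<Longrightarrow> \<not> fp_model cex_prime"
    unfolding cex_prime_def by blast+
qed

typedef cex = "{0..<cex_prime}"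
  using prime_gt_0_nat[OF cex_prime(1)] by (intro exI[of _ 0]) simp

lemma CARD_cex: "CARD(cex) = cex_prime"
  using type_definition.card[OF type_definition_cex] by simp

instance cex :: prime_card
  by standard (simp add: CARD_cex cex_prime(1))

lemma fp_model: "prime p \<Longrightarrow> fp_model p"
  using fp_model_CARD[where 'a = cex] cex_prime(2) by (auto simp: CARD_cex)

section \<open>Factors of bounded degree\<close>

text \<open>Splitting off a root z turns coefficients h_i into h_(i-1) - z * h_i, which costs a
  factor of at most 1 + R per root.\<close>

lemma norm_coeff_le_of_roots:
  fixes g :: "complex poly"
  assumes "lead_coeff g = 1" "\<And>z. poly g z = 0 \<Longrightarrow> norm z \<le> R" "R \<ge> 0"
  shows "norm (coeff g i) \<le> (1 + R) ^ degree g"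
  using assms(1,2)
proof (induction "degree g" arbitrary: g i)
  case 0
  then obtain a where "g = [:a:]" by (metis degree_0_id)
  with 0 show ?case by (cases i) auto
next
  case (Suc d)
  have "\<not> constant (poly g)" using Suc.hyps(2) by (simp add: constant_degree)
  then obtain z where z: "poly g z = 0" using fundamental_theorem_of_algebra by blast
  then obtain h where h: "g = [:- z, 1:] * h" using poly_eq_0_iff_dvd by (metis dvdE)
  have "lead_coeff g = lead_coeff [:- z, 1:] * lead_coeff h" unfolding h by (rule lead_coeff_mult)
  hence lh: "lead_coeff h = 1" using Suc.prems(1) by simp
  hence "h \<noteq> 0" by auto
  hence "degree g = 1 + degree h" unfolding h by (subst degree_mult_eq) auto
  hence dh: "d = degree h" using Suc.hyps(2) by simp
  have hR: "norm (coeff h j) \<le> (1 + R) ^ d" for j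
    using Suc.hyps(1)[OF dh lh] Suc.prems(2) h by (simp add: dh)
  have "norm (coeff g i) \<le> norm (z * coeff h i) + (1 + R) ^ d"
  proof (cases i)
    case 0
    have "0 \<le> (1 + R) ^ d" using assms(3) by simp
    thus ?thesis using 0 by (simp add: h)
  next
    case (Suc j)
    have "coeff g i = coeff h j - z * coeff h i" by (simp add: h Suc)
    also have "norm \<dots> \<le> norm (coeff h j) + norm (z * coeff h i)" by (rule norm_triangle_ineq4)
    finally show ?thesis using hR[of j] by simp
  qed
  also have "norm (z * coeff h i) \<le> R * (1 + R) ^ d"
    unfolding norm_mult using Suc.prems(2)[OF z] hR[of i] assms(3) by (intro mult_mono) auto
  finally show ?case using Suc.hyps(2)[symmetric] by (simp add: algebra_simps)
qed

lemma poly_of_int_mpoly: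
  "poly (of_int_poly (mpoly n c)) \<alpha> = \<alpha> ^ n + (\<Sum>i<n. of_int (c i) * \<alpha> ^ i)" for \<alpha> :: complex
proof -
  have "of_int_poly (mpoly n c) = (mpoly n (of_int \<circ> c) :: complex poly)"
    by (rule poly_eqI) (simp add: coeff_map_poly coeff_mpoly)
  thus ?thesis by (simp add: mpoly_def poly_monom poly_sum)
qed

text \<open>Cauchy's bound: for r = norm \<alpha> > L + 1 the lower terms amount to at most L * (r ^
  n - 1) / (r - 1) <= r ^ n - 1.\<close>

lemma norm_root_mpoly_le:
  assumes "poly (of_int_poly (mpoly n c)) (\<alpha> :: complex) = 0" "\<And>i. i < n \<Longrightarrow> \<bar>c i\<bar> \<le> int L"
  shows "norm \<alpha> \<le> real L + 1"
proof (rule ccontr)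
  assume "\<not> norm \<alpha> \<le> real L + 1"
  hence r: "norm \<alpha> > real L + 1" by simp
  let ?r = "norm \<alpha>"
  have "\<alpha> ^ n = - (\<Sum>i<n. of_int (c i) * \<alpha> ^ i)"
    using assms(1) by (simp add: poly_of_int_mpoly eq_neg_iff_add_eq_0)
  hence "?r ^ n = norm (\<Sum>i<n. of_int (c i) * \<alpha> ^ i)" by (metis norm_minus_cancel norm_power)
  also have "\<dots> \<le> (\<Sum>i<n. real L * ?r ^ i)"
  proof (rule order_trans[OF norm_sum], intro sum_mono)
    fix i assume "i \<in> {..<n}"
    hence "\<bar>c i\<bar> \<le> int L" using assms(2) by simp
    hence "real_of_int \<bar>c i\<bar> \<le> real_of_int (int L)" by (intro of_int_le_iff[THEN iffD2])
    thus "norm (of_int (c i) * \<alpha> ^ i) \<le> real L * ?r ^ i"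
      by (simp add: norm_mult norm_power mult_right_mono)
  qed
  also have "\<dots> = real L * ((1 - ?r ^ n) / (1 - ?r))"
    using r by (simp add: sum_gp_strict flip: sum_distrib_left)
  also have "\<dots> = (real L / (?r - 1)) * (?r ^ n - 1)"
  proof -
    have "(1 - ?r ^ n) / (1 - ?r) = (?r ^ n - 1) / (?r - 1)" by (metis minus_diff_eq minus_divide_divide)
    thus ?thesis by simp
  qed
  also have "\<dots> \<le> 1 * (?r ^ n - 1)"
    using r by (intro mult_right_mono) (auto simp: field_simps intro!: one_le_power)
  finally show False by simp
qed

text \<open>The bound is (1 + R) ^ K for the root bound R = L + 1, independent of n. Excluding 0 is
  harmless because the constant coefficient of \<open>mpoly n c\<close> is at least 1 for n >=
  1.\<close>

definition cand_roots :: "nat \<Rightarrow> nat \<Rightarrow> complex set" where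
  "cand_roots L K = {\<alpha>. \<alpha> \<noteq> 0 \<and> (\<exists>g. lead_coeff g = 1 \<and> degree g \<le> K \<and>
      (\<forall>i. \<bar>coeff g i\<bar> \<le> int (L + 2) ^ K) \<and> poly (of_int_poly g) \<alpha> = 0)}"

lemma finite_cand_roots: "finite (cand_roots L K)"
proof -
  let ?B = "int (L + 2) ^ K"
  let ?G = "\<Union>d\<le>K. mpoly d ` (PiE {..<d} (\<lambda>_. {- ?B..?B}))"
  have "finite ?G" by (intro finite_UN_I finite_imageI finite_PiE) auto
  moreover have "finite {\<alpha>. poly (of_int_poly g :: complex poly) \<alpha> = 0}" if g: "g \<in> ?G" for g
  proof (rule poly_roots_finite)
    obtain d c where "g = mpoly d c" using g by blast
    hence "lead_coeff g = 1" by (simp only: lead_coeff_mpoly)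
    hence "g \<noteq> 0" by auto
    thus "of_int_poly g \<noteq> (0 :: complex poly)" by simp
  qed
  ultimately have "finite (\<Union>g\<in>?G. {\<alpha>. poly (of_int_poly g :: complex poly) \<alpha> = 0})"
    by (rule finite_UN_I)
  moreover have "cand_roots L K \<subseteq> (\<Union>g\<in>?G. {\<alpha>. poly (of_int_poly g :: complex poly) \<alpha> = 0})"
  proof
    fix \<alpha> assume "\<alpha> \<in> cand_roots L K"
    then obtain g where g: "lead_coeff g = 1" "degree g \<le> K" "\<forall>i. \<bar>coeff g i\<bar> \<le> ?B"
      "poly (of_int_poly g) \<alpha> = 0" unfolding cand_roots_def by blast
    have "- ?B \<le> coeff g i \<and> coeff g i \<le> ?B" for i using g(3)[rule_format, of i] by linarith
    hence "g \<in> {f. lead_coeff f = 1 \<and> degree f = degree g \<and> (\<forall>i<degree g. coeff f i \<in> {- ?B..?B})}"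
      using g by simp
    also have "\<dots> = mpoly (degree g) ` (PiE {..<degree g} (\<lambda>_. {- ?B..?B}))"
      using bij_betw_mpoly[of "degree g" "{- ?B..?B}"] by (simp only: bij_betw_def)
    finally have "g \<in> ?G" using g(2) by blast
    thus "\<alpha> \<in> (\<Union>g\<in>?G. {\<alpha>. poly (of_int_poly g :: complex poly) \<alpha> = 0})" using g(4) by blast
  qed
  ultimately show ?thesis by (rule finite_subset[rotated])
qed

text \<open>Roots of g are roots of f, so the root bound for f bounds the coefficients of g.\<close>

lemma low_degree_factor_root:
  assumes c: "c \<in> PiE {..<n} (\<lambda>_. {1..int L})" and n: "n \<ge> 1"
    and g: "lead_coeff g = 1" "1 \<le> degree g" "degree g \<le> K" "g dvd mpoly n c"
  shows "\<exists>\<alpha>\<in>cand_roots L K. poly (of_int_poly (mpoly n c)) \<alpha> = 0"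
proof -
  let ?g = "of_int_poly g :: complex poly"
  let ?f = "of_int_poly (mpoly n c) :: complex poly"
  have dg: "degree ?g = degree g" by (simp add: degree_map_poly)
  have dvd: "?g dvd ?f" using g(4) by (rule of_int_poly_hom.hom_dvd)
  have root: "poly ?f \<alpha> = 0" if "poly ?g \<alpha> = 0" for \<alpha>
    using that dvd by (auto elim!: dvdE)
  have le: "norm \<alpha> \<le> real L + 1" if "poly ?g \<alpha> = 0" for \<alpha>
    using root[OF that] by (rule norm_root_mpoly_le) (use c in \<open>force simp: PiE_iff\<close>)
  have "norm (coeff ?g i) \<le> (1 + (real L + 1)) ^ degree ?g" for i
    by (rule norm_coeff_le_of_roots) (use g dg le in \<open>auto simp: coeff_map_poly\<close>)
  also have "\<dots> \<le> (1 + (real L + 1)) ^ K"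
    using g dg by (intro power_increasing) auto
  finally have "real_of_int \<bar>coeff g i\<bar> \<le> real_of_int (int (L + 2) ^ K)" for i
    by (simp add: coeff_map_poly add.commute)
  hence coeffs: "\<bar>coeff g i\<bar> \<le> int (L + 2) ^ K" for i using of_int_le_iff by blast
  have "\<not> constant (poly ?g)" using g dg by (simp add: constant_degree)
  then obtain \<alpha> where \<alpha>: "poly ?g \<alpha> = 0" using fundamental_theorem_of_algebra by blast
  have "\<alpha> \<noteq> 0"
  proof
    assume "\<alpha> = 0"
    hence "poly ?f 0 = 0" using root \<alpha> by blast
    hence "c 0 = 0" using n by (simp add: poly_0_coeff_0 coeff_map_poly coeff_mpoly)
    moreover have "c 0 \<in> {1..int L}" using PiE_mem[OF c, of 0] n by simp
    ultimately show False by simp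
  qed
  hence "\<alpha> \<in> cand_roots L K" using \<alpha> g coeffs unfolding cand_roots_def by blast
  thus ?thesis using root[OF \<alpha>] by blast
qed

section \<open>Probability that a fixed nonzero number is a root\<close>

definition root_tuples :: "nat \<Rightarrow> complex \<Rightarrow> nat \<Rightarrow> (nat \<Rightarrow> int) set" where
  "root_tuples L \<alpha> n = {c \<in> PiE {..<n} (\<lambda>_. {1..int L}). poly (of_int_poly (mpoly n c)) \<alpha> = 0}"

lemma card_box: "card (PiE {..<n::nat} (\<lambda>_. {1..int L})) = L ^ n"
  by (simp add: card_PiE)

lemma finite_box: "finite (PiE {..<n::nat} (\<lambda>_. {1..int L}))"
  by (intro finite_PiE) auto

text \<open>
  Shifting one coordinate cyclically in \<open>{1..L}\<close> turns the value \<open>0\<close> into \<open>\<alpha> ^ i\<close> or \<open>(1 - L) * \<alpha> ^ i\<close>, which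
  determines \<open>i\<close>; so the shifts of the tuples counted here overlap at most twice.
\<close>

lemma card_root_tuples_le_non_root_of_unity:
  assumes L: "L \<ge> 2" and \<alpha>: "\<alpha> \<noteq> 0" "\<And>m. m \<ge> 1 \<Longrightarrow> \<alpha> ^ m \<noteq> 1"
  shows "n * card (root_tuples L \<alpha> n) \<le> 2 * L ^ n"
proof -
  define v where "v c = \<alpha> ^ n + (\<Sum>i<n. of_int (c i) * \<alpha> ^ i)" for c :: "nat \<Rightarrow> int"
  have v_upd: "v (c(i := x)) = v c + (of_int x - of_int (c i)) * \<alpha> ^ i" if "i < n" for c i x
  proof -
    have "(\<Sum>j<n. of_int ((c(i := x)) j) * \<alpha> ^ j) =
        (\<Sum>j<n. of_int (c j) * \<alpha> ^ j + (if j = i then (of_int x - of_int (c i)) * \<alpha> ^ i else 0))"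
      by (intro sum.cong) (auto simp: algebra_simps)
    thus ?thesis using that by (simp add: v_def sum.distrib)
  qed
  have root_tuples_iff: "c \<in> root_tuples L \<alpha> n \<longleftrightarrow> c \<in> PiE {..<n} (\<lambda>_. {1..int L}) \<and> v c = 0" for c
    by (simp add: root_tuples_def v_def poly_of_int_mpoly)
  have inj: "i = j" if "\<alpha> ^ i = \<alpha> ^ j" for i j
  proof -
    have "i \<ge> j" if "\<alpha> ^ i = \<alpha> ^ j" for i j
    proof (rule ccontr)
      assume "\<not> i \<ge> j"
      hence "\<alpha> ^ j = \<alpha> ^ i * \<alpha> ^ (j - i)" by (simp flip: power_add)
      hence "\<alpha> ^ (j - i) = 1" using that \<alpha>(1) by simp
      thus False using \<alpha>(2)[of "j - i"] \<open>\<not> i \<ge> j\<close> by simp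
    qed
    from this[of i j] this[of j i] that show ?thesis by simp
  qed
  define N1 where "N1 = {(i,c). i < n \<and> c \<in> root_tuples L \<alpha> n \<and> c i < int L}"
  define N2 where "N2 = {(i,c). i < n \<and> c \<in> root_tuples L \<alpha> n \<and> c i = int L}"
  have fin_root: "finite (root_tuples L \<alpha> n)" unfolding root_tuples_def using finite_box by simp
  have split: "{..<n} \<times> root_tuples L \<alpha> n = N1 \<union> N2"
    by (auto simp: N1_def N2_def root_tuples_iff PiE_iff order_le_less)
  have "finite ({..<n} \<times> root_tuples L \<alpha> n)" using fin_root by simp
  hence fin: "finite N1" "finite N2" unfolding split by auto
  have upd_box: "c(i := x) \<in> PiE {..<n} (\<lambda>_. {1..int L})"
    if "c \<in> PiE {..<n} (\<lambda>_. {1..int L})" "i < n" "x \<in> {1..int L}" for c i x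
    using that by (auto simp: PiE_iff extensional_def)
  have "card N1 \<le> card (PiE {..<n} (\<lambda>_. {1..int L}))"
  proof (rule card_inj_on_le[where f = "\<lambda>(i,c). c(i := c i + 1)"])
    show "(\<lambda>(i,c). c(i := c i + 1)) ` N1 \<subseteq> PiE {..<n} (\<lambda>_. {1..int L})"
    proof clarify
      fix i c assume "(i,c) \<in> N1"
      hence *: "i < n" "c \<in> PiE {..<n} (\<lambda>_. {1..int L})" "c i < int L" by (auto simp: N1_def root_tuples_iff)
      moreover have "c i \<in> {1..int L}" using PiE_mem[OF *(2), of i] *(1) by simp
      ultimately show "c(i := c i + 1) \<in> PiE {..<n} (\<lambda>_. {1..int L})" by (intro upd_box) auto
    qed
    show "inj_on (\<lambda>(i,c). c(i := c i + 1)) N1"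
    proof (rule inj_onI, clarify)
      fix i c j d assume *: "(i,c) \<in> N1" "(j,d) \<in> N1" "c(i := c i + 1) = d(j := d j + 1)"
      have "v (c(i := c i + 1)) = \<alpha> ^ i" "v (d(j := d j + 1)) = \<alpha> ^ j"
        using * by (subst v_upd; simp add: N1_def root_tuples_iff)+
      hence ij: "i = j" using * inj by metis
      have "c x = d x" for x using fun_cong[OF *(3), of x] by (cases "x = i") (auto simp: ij)
      thus "i = j \<and> c = d" using ij by blast
    qed
  qed (rule finite_box)
  moreover have "card N2 \<le> card (PiE {..<n} (\<lambda>_. {1..int L}))"
  proof (rule card_inj_on_le[where f = "\<lambda>(i,c). c(i := 1)"])
    show "(\<lambda>(i,c). c(i := 1)) ` N2 \<subseteq> PiE {..<n} (\<lambda>_. {1..int L})"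
    proof clarify
      fix i c assume "(i,c) \<in> N2"
      thus "c(i := 1) \<in> PiE {..<n} (\<lambda>_. {1..int L})" using L by (intro upd_box) (auto simp: N2_def root_tuples_iff)
    qed
    show "inj_on (\<lambda>(i,c). c(i := 1)) N2"
    proof (rule inj_onI, clarify)
      fix i c j d assume *: "(i,c) \<in> N2" "(j,d) \<in> N2" "c(i := 1) = d(j := 1)"
      have "v (c(i := 1)) = (1 - of_nat L) * \<alpha> ^ i" "v (d(j := 1)) = (1 - of_nat L) * \<alpha> ^ j"
        using * by (subst v_upd; simp add: N2_def root_tuples_iff)+
      moreover have "(1 - of_nat L :: complex) \<noteq> 0"
        using L
      proof -
        have "(1 :: nat) \<noteq> L" using L by simp
        hence "(of_nat 1 :: complex) \<noteq> of_nat L" by (simp only: of_nat_eq_iff not_False_eq_True)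
        thus ?thesis by simp
      qed
      ultimately have "\<alpha> ^ i = \<alpha> ^ j" using *(3) by simp
      hence ij: "i = j" by (rule inj)
      have "c x = d x" for x using fun_cong[OF *(3), of x] * by (cases "x = i") (auto simp: ij N2_def)
      thus "i = j \<and> c = d" using ij by blast
    qed
  qed (rule finite_box)
  moreover have "n * card (root_tuples L \<alpha> n) = card ({..<n} \<times> root_tuples L \<alpha> n)"
    by (simp add: card_cartesian_product)
  moreover have "card (N1 \<union> N2) \<le> card N1 + card N2" by (rule card_Un_le)
  ultimately show ?thesis unfolding split by (simp add: card_box)
qed

text \<open>
  If \<open>\<alpha>\<close> is a root of unity of order \<open>m\<close>, the coefficients at multiples of \<open>m\<close> contribute a sum of integers.
  Each of them is, with probability \<open>2 / L\<close>, a fair choice between \<open>1\<close> and \<open>2\<close>; the operator \<open>coin j\<close> adds \<open>j\<close>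
  such choices (between \<open>0\<close> and \<open>1\<close>) to a distribution given by its point masses.
\<close>

primrec atom :: "nat \<Rightarrow> complex \<Rightarrow> nat \<Rightarrow> complex \<Rightarrow> real" where
  "atom L \<alpha> 0 x = of_bool (x = 0)"
| "atom L \<alpha> (Suc n) x = (\<Sum>v\<in>{1..L}. atom L \<alpha> n (x - of_nat v * \<alpha> ^ n)) / real L"

primrec coin :: "nat \<Rightarrow> (complex \<Rightarrow> real) \<Rightarrow> complex \<Rightarrow> real" where
  "coin 0 f x = f x"
| "coin (Suc j) f x = (coin j f x + coin j f (x - 1)) / 2"

text \<open>Both operations are convolutions and therefore commute; this moves \<open>coin\<close>
  through the recursion of \<open>atom\<close>.\<close>

lemma coin_sum:
  "coin j (\<lambda>x. (\<Sum>v\<in>V. f (x - h v)) / c) x = (\<Sum>v\<in>V. coin j f (x - h v)) / c"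
proof (induction j arbitrary: x)
  case (Suc j)
  have "x - 1 - h v = x - h v - 1" for v by simp
  thus ?case
    by (simp only: coin.simps Suc) (simp add: sum.distrib add_divide_distrib mult.commute flip: sum_divide_distrib)
qed simp

lemma coin_add_le: "(\<And>x. coin j f x \<le> b) \<Longrightarrow> coin (j + d) f x \<le> b"
proof (induction d arbitrary: x)
  case (Suc d)
  from Suc.IH[OF Suc.prems, of x] Suc.IH[OF Suc.prems, of "x - 1"] show ?case by simp
qed simp

lemma coin_delta_not_Nats: "x \<notin> \<nat> \<Longrightarrow> coin j (\<lambda>x. of_bool (x = 0)) x = 0"
proof (induction j arbitrary: x)
  case 0
  thus ?case by auto
next
  case (Suc j)
  have "x - 1 \<notin> \<nat>" using Suc.prems Nats_1 Nats_add[of "x - 1" 1] by auto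
  thus ?case using Suc by simp
qed

lemma coin_delta_of_nat: "coin j (\<lambda>x. of_bool (x = 0)) (of_nat k) = real (j choose k) / 2 ^ j"
proof (induction j arbitrary: k)
  case 0
  show ?case by (cases k) (auto simp del: of_nat_Suc)
next
  case (Suc j)
  show ?case
  proof (cases k)
    case 0
    have "(- 1 :: complex) \<notin> \<nat>"
    proof
      assume "(- 1 :: complex) \<in> \<nat>"
      then obtain m where "(- 1 :: complex) = of_nat m" by (rule Nats_cases)
      from this[symmetric] have "of_nat (Suc m) = (0 :: complex)" by simp
      thus False by (metis of_nat_eq_0_iff nat.distinct(1))
    qed
    thus ?thesis using Suc[of 0] 0 coin_delta_not_Nats[of "-1" j] by simp
  next
    case (Suc k')
    have "of_nat k - 1 = (of_nat k' :: complex)" by (simp add: Suc)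
    thus ?thesis using Suc.IH[of k] Suc.IH[of k'] by (simp add: Suc add_divide_distrib)
  qed
qed

lemma central_binomial_eq_cbin: "real ((2 * m) choose m) = 4 ^ m * cbin m"
proof (induction m)
  case (Suc m)
  have 1: "(2 * Suc m) choose Suc m = 2 * (Suc (2 * m) choose m)"
    by (simp add: binomial_symmetric[of m "Suc (2 * m)"])
  have "Suc m * (Suc (2 * m) choose m) = Suc (2 * m) * (2 * m choose m)"
    using Suc_times_binomial_eq[of "2 * m" m] binomial_symmetric[of m "Suc (2 * m)"]
    by (simp del: binomial_Suc_Suc add: mult.commute)
  hence "real (Suc m) * real (Suc (2 * m) choose m) = real (Suc (2 * m)) * real (2 * m choose m)"
    by (metis of_nat_mult)
  hence "real (Suc (2 * m) choose m) = real (Suc (2 * m)) * real (2 * m choose m) / real (Suc m)"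
    by (simp add: field_simps)
  thus ?case unfolding 1 of_nat_mult using Suc by (simp add: field_simps)
qed simp

text \<open>The largest mass of 2 * m fair coins is the central one, \<open>cbin m\<close>, and
  further averaging cannot raise the maximum.\<close>

lemma coin_delta_le:
  assumes "2 * m \<le> j"
  shows "coin j (\<lambda>x. of_bool (x = 0)) x \<le> cbin m"
proof -
  have "coin (2 * m) (\<lambda>x. of_bool (x = 0)) x \<le> cbin m" for x
  proof (cases "x \<in> \<nat>")
    case True
    then obtain k where x: "x = of_nat k" by (rule Nats_cases)
    have "real (2 * m choose k) \<le> real (2 * m choose m)" using binomial_maximum'[of m k] by simp
    also have "\<dots> = 2 ^ (2 * m) * cbin m" by (simp add: central_binomial_eq_cbin power_mult)
    finally show ?thesis unfolding x coin_delta_of_nat by (simp add: divide_le_eq mult.commute)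
  qed (simp add: coin_delta_not_Nats less_imp_le[OF cbin_pos])
  from coin_add_le[of "2 * m", OF this, of "j - 2 * m"] show ?thesis using assms by simp
qed

text \<open>Once J coins are collected, all point masses are at most \<epsilon>. The second term is
  a Markov bound on having fewer: 2 ^ J times the expectation of (1/2) ^ (number of coins), j of
  which are already in hand. A position divisible by m yields a coin with probability 2 / L and
  multiplies the expectation by (1 - 2 / L) + (2 / L) / 2 = 1 - 1 / L.\<close>

lemma coin_atom_le:
  assumes L: "L \<ge> 2" and \<alpha>: "\<alpha> ^ m = 1"
    and J: "\<And>j x. j \<ge> J \<Longrightarrow> coin j (\<lambda>x. of_bool (x = 0)) x \<le> \<epsilon>" and \<epsilon>: "\<epsilon> \<ge> 0"
  shows "coin j (atom L \<alpha> n) x \<le> \<epsilon> + 2 ^ J * (1 / 2) ^ j * (1 - 1 / real L) ^ card {i. i < n \<and> m dvd i}"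
proof (induction n arbitrary: j x)
  case 0
  have *: "atom L \<alpha> 0 = (\<lambda>x. of_bool (x = 0))" by (rule ext) simp
  show ?case
  proof (cases "j \<ge> J")
    case True
    thus ?thesis using J[OF True, of x] unfolding * by (simp add: add_increasing2)
  next
    case False
    have "coin j (\<lambda>x. of_bool (x = 0)) x \<le> 1" using coin_delta_le[of 0 j x] by simp
    also have "(1 :: real) \<le> 2 ^ J * (1 / 2) ^ j"
      using False power_increasing[of j J "2 :: real"] by (simp add: power_one_over field_simps)
    finally show ?thesis using \<epsilon> unfolding * by (simp del: atom.simps)
  qed
next
  case (Suc n)
  let ?c = "card {i. i < n \<and> m dvd i}"
  let ?r = "1 - 1 / real L"
  let ?b = "\<lambda>j. \<epsilon> + 2 ^ J * (1 / 2) ^ j * ?r ^ ?c"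
  have "atom L \<alpha> (Suc n) = (\<lambda>x. (\<Sum>v\<in>{1..L}. atom L \<alpha> n (x - of_nat v * \<alpha> ^ n)) / real L)"
    by (rule ext) simp
  hence eq: "coin j (atom L \<alpha> (Suc n)) x = (\<Sum>v\<in>{1..L}. coin j (atom L \<alpha> n) (x - of_nat v * \<alpha> ^ n)) / real L"
    by (simp only: coin_sum[where f = "atom L \<alpha> n" and h = "\<lambda>v. of_nat v * \<alpha> ^ n"])
  show ?case
  proof (cases "m dvd n")
    case False
    hence "{i. i < Suc n \<and> m dvd i} = {i. i < n \<and> m dvd i}" by (auto simp: less_Suc_eq)
    moreover have "(\<Sum>v\<in>{1..L}. coin j (atom L \<alpha> n) (x - of_nat v * \<alpha> ^ n)) \<le> (\<Sum>v\<in>{1..L}. ?b j)"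
      by (intro sum_mono Suc)
    ultimately show ?thesis unfolding eq using L by (simp add: divide_le_eq mult.commute)
  next
    case True
    hence "{i. i < Suc n \<and> m dvd i} = insert n {i. i < n \<and> m dvd i}" by (auto simp: less_Suc_eq)
    hence card: "card {i. i < Suc n \<and> m dvd i} = Suc ?c" by simp
    have \<alpha>n: "\<alpha> ^ n = 1" using True \<alpha> by (auto elim!: dvdE simp: power_mult)
    \<comment> \<open>As \<alpha> ^ n = 1, the values v = 1 and v = 2 together make twice one
      further coin, evaluated at x - 1.\<close>
    have split: "{1..L} = insert 1 (insert 2 {3..L})" using L by auto
    have "(\<Sum>v\<in>{1..L}. coin j (atom L \<alpha> n) (x - of_nat v * \<alpha> ^ n)) =
        2 * coin (Suc j) (atom L \<alpha> n) (x - 1) + (\<Sum>v\<in>{3..L}. coin j (atom L \<alpha> n) (x - of_nat v * \<alpha> ^ n))"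
      unfolding split by (simp add: \<alpha>n)
    also have "\<dots> \<le> 2 * ?b (Suc j) + (\<Sum>v\<in>{3..L}. ?b j)"
      by (intro add_mono mult_left_mono sum_mono Suc) auto
    also have "\<dots> = 2 * ?b (Suc j) + (real L - 2) * ?b j" using L by (simp add: of_nat_diff)
    also have "\<dots> = real L * (\<epsilon> + 2 ^ J * (1 / 2) ^ j * ?r ^ Suc ?c)"
    proof -
      have "2 * (\<epsilon> + A * (1 / 2)) + (l - 2) * (\<epsilon> + A) = l * (\<epsilon> + A * (1 - 1 / l))" if "l \<noteq> 0" for A l :: real
      proof -
        have "l * (1 - 1 / l) = l - 1" using that by (simp add: right_diff_distrib)
        hence "l * (\<epsilon> + A * (1 - 1 / l)) = l * \<epsilon> + (l - 1) * A" by (simp add: distrib_left mult.left_commute mult.commute)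
        thus ?thesis by (simp add: algebra_simps)
      qed
      from this[of "real L" "2 ^ J * (1 / 2) ^ j * ?r ^ ?c"] L
      have "2 * (\<epsilon> + 2 ^ J * (1 / 2) ^ j * ?r ^ ?c * (1 / 2)) + (real L - 2) * ?b j =
        real L * (\<epsilon> + 2 ^ J * (1 / 2) ^ j * ?r ^ ?c * ?r)" by linarith
      thus ?thesis by (simp only: power_Suc mult.commute mult.left_commute mult.assoc)
    qed
    finally show ?thesis unfolding eq card using L by (simp add: divide_le_eq mult.commute)
  qed
qed

lemma card_eq_atom:
  assumes "L > 0"
  shows "real (card {c \<in> PiE {..<n} (\<lambda>_. {1..int L}). (\<Sum>i<n. of_int (c i) * \<alpha> ^ i) = x}) = atom L \<alpha> n x * real L ^ n"
proof (induction n arbitrary: x)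
  case 0
  show ?case by auto
next
  case (Suc n)
  let ?S = "\<lambda>n x. {c \<in> PiE {..<n} (\<lambda>_. {1..int L}). (\<Sum>i<n. of_int (c i) * \<alpha> ^ i) = x}"
  let ?T = "SIGMA v:{1..L}. ?S n (x - of_nat v * \<alpha> ^ n)"
  have sum_upd: "(\<Sum>i<n. of_int ((c(n := y)) i) * \<alpha> ^ i) = (\<Sum>i<n. of_int (c i) * \<alpha> ^ i)" for c :: "nat \<Rightarrow> int" and y
    by (intro sum.cong) auto
  have "bij_betw (\<lambda>(v,c). c(n := int v)) ?T (?S (Suc n) x)"
  proof (rule bij_betwI[where g = "\<lambda>c. (nat (c n), restrict c {..<n})"])
    show "(\<lambda>(v,c). c(n := int v)) \<in> ?T \<rightarrow> ?S (Suc n) x"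
    proof clarify
      fix v c assume v: "v \<in> {1..L}" and c: "c \<in> PiE {..<n} (\<lambda>_. {1..int L})"
        and sum: "(\<Sum>i<n. of_int (c i) * \<alpha> ^ i) = x - of_nat v * \<alpha> ^ n"
      have "c(n := int v) \<in> PiE {..<Suc n} (\<lambda>_. {1..int L})"
        using v c by (auto simp: PiE_iff extensional_def less_Suc_eq)
      moreover have "(\<Sum>i<Suc n. of_int ((c(n := int v)) i) * \<alpha> ^ i) = x"
        using sum sum_upd[of c "int v"] by simp
      ultimately show "c(n := int v) \<in> PiE {..<Suc n} (\<lambda>_. {1..int L}) \<and> (\<Sum>i<Suc n. of_int ((c(n := int v)) i) * \<alpha> ^ i) = x"
        by blast
    qed
  next
    show "(\<lambda>c. (nat (c n), restrict c {..<n})) \<in> ?S (Suc n) x \<rightarrow> ?T"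
    proof
      fix c assume c: "c \<in> ?S (Suc n) x"
      have "c i \<in> {1..int L}" if "i < Suc n" for i using c that by blast
      moreover from this[of n] have "int (nat (c n)) = c n" "nat (c n) \<in> {1..L}" by auto
      moreover from this(1) have "(of_nat (nat (c n)) :: complex) = of_int (c n)" by (metis of_int_of_nat_eq)
      ultimately show "(nat (c n), restrict c {..<n}) \<in> ?T" using c by (auto simp: eq_diff_eq)
    qed
  next
    fix a assume "a \<in> ?T"
    then obtain v c where a: "a = (v, c)" "c \<in> PiE {..<n} (\<lambda>_. {1..int L})" by blast
    have "restrict (c(n := int v)) {..<n} = c"
      using a(2) by (auto simp: fun_eq_iff restrict_def PiE_iff extensional_def)
    thus "(\<lambda>c. (nat (c n), restrict c {..<n})) ((\<lambda>(v,c). c(n := int v)) a) = a" by (simp add: a)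
  next
    fix c assume c: "c \<in> ?S (Suc n) x"
    have "c n \<in> {1..int L}" using c by blast
    moreover have "c i = undefined" if "i \<ge> Suc n" for i
      using c that PiE_arb[of c "{..<Suc n}" _ i] by auto
    ultimately show "(\<lambda>(v,c). c(n := int v)) ((\<lambda>c. (nat (c n), restrict c {..<n})) c) = c"
      by (auto simp: fun_eq_iff)
  qed
  from bij_betw_same_card[OF this]
  have "real (card (?S (Suc n) x)) = real (card ?T)" by simp
  also have "\<dots> = (\<Sum>v\<in>{1..L}. real (card (?S n (x - of_nat v * \<alpha> ^ n))))"
    using finite_box[of n L] by (subst card_SigmaI) auto
  also have "\<dots> = (\<Sum>v\<in>{1..L}. atom L \<alpha> n (x - of_nat v * \<alpha> ^ n) * real L ^ n)"
    by (intro sum.cong refl Suc)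
  also have "\<dots> = atom L \<alpha> (Suc n) x * real L ^ Suc n"
    using assms by (simp flip: sum_distrib_right)
  finally show ?case .
qed

lemma root_tuples_root_of_unity_tendsto_0:
  assumes L: "L \<ge> 2" and m: "m \<ge> 1" "\<alpha> ^ m = 1"
  shows "(\<lambda>n. real (card (root_tuples L \<alpha> n)) / real L ^ n) \<longlonglongrightarrow> 0"
proof (rule LIMSEQ_I)
  fix e :: real assume e: "e > 0"
  obtain k :: nat where k: "k > 0" "1 / real k < e / 2"
    using e by (metis half_gt_zero nat_approx_posE zero_less_Suc inverse_eq_divide)
  have "cbin (k ^ 2) \<le> 1 / sqrt (real (k ^ 2))"
    using k by (intro order_trans[OF cbin_le] frac_le real_sqrt_le_mono) auto
  also have "\<dots> = 1 / real k" by simp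
  finally have ck: "cbin (k ^ 2) \<le> e / 2" using k by linarith
  \<comment> \<open>So many coins spread the mass below e / 2, since \<open>cbin (k ^ 2)\<close> <=
    1 / k.\<close>
  define J where "J = 2 * k ^ 2"
  have J: "coin j (\<lambda>x. of_bool (x = 0)) x \<le> e / 2" if "j \<ge> J" for j x
    using coin_delta_le[of "k ^ 2" j x] that ck by (simp add: J_def)
  let ?r = "1 - 1 / real L"
  have r: "0 \<le> ?r" "?r < 1" using L by auto
  have lim: "(\<lambda>N. 2 ^ J * ?r ^ N) \<longlonglongrightarrow> 0"
    using tendsto_mult_left[OF LIMSEQ_realpow_zero[OF r], of "2 ^ J"] by (simp only: mult_zero_right)
  obtain N where N': "\<forall>k\<ge>N. norm (2 ^ J * ?r ^ k - 0) < e / 2"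
    using LIMSEQ_D[OF lim half_gt_zero[OF e]] by blast
  have N: "2 ^ J * ?r ^ k < e / 2" if "k \<ge> N" for k
    using N'[rule_format, OF that] by (simp only: diff_zero real_norm_def abs_less_iff)
  show "\<exists>no. \<forall>n\<ge>no. norm (real (card (root_tuples L \<alpha> n)) / real L ^ n - 0) < e"
  proof (intro exI allI impI)
    fix n assume n: "n \<ge> N * m"
    let ?D = "{i. i < n \<and> m dvd i}"
    have "(\<lambda>k. m * k) ` {..<n div m} \<subseteq> ?D"
    proof clarify
      fix k assume "k < n div m"
      hence "m * k < m * (n div m)" using m by simp
      thus "m * k < n \<and> m dvd m * k"
        by (intro conjI dvd_triv_left) (erule less_le_trans, rule times_div_less_eq_dividend)
    qed
    moreover have "inj_on (\<lambda>k. m * k) {..<n div m}" using m by (auto simp: inj_on_def)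
    ultimately have "card {..<n div m} \<le> card ?D" by (intro card_inj_on_le) auto
    moreover have "N \<le> n div m" using n m div_le_mono[OF n, of m] by simp
    ultimately have D: "card ?D \<ge> N" by simp
    have "root_tuples L \<alpha> n = {c \<in> PiE {..<n} (\<lambda>_. {1..int L}). (\<Sum>i<n. of_int (c i) * \<alpha> ^ i) = - (\<alpha> ^ n)}"
      by (auto simp: root_tuples_def poly_of_int_mpoly eq_neg_iff_add_eq_0 add.commute)
    hence "real (card (root_tuples L \<alpha> n)) / real L ^ n = coin 0 (atom L \<alpha> n) (- (\<alpha> ^ n))"
      using L card_eq_atom[of L n \<alpha> "- (\<alpha> ^ n)"] by simp
    also have "\<dots> \<le> e / 2 + 2 ^ J * (1 / 2) ^ 0 * ?r ^ card ?D"
      by (rule coin_atom_le[OF L m(2) J]) (use e in auto)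
    also have "\<dots> < e" using N[OF D] by simp
    finally show "norm (real (card (root_tuples L \<alpha> n)) / real L ^ n - 0) < e" by simp
  qed
qed

lemma root_tuples_tendsto_0:
  assumes L: "L \<ge> 2" and \<alpha>: "\<alpha> \<noteq> 0"
  shows "(\<lambda>n. real (card (root_tuples L \<alpha> n)) / real L ^ n) \<longlonglongrightarrow> 0"
proof (cases "\<exists>m\<ge>1. \<alpha> ^ m = 1")
  case True
  thus ?thesis using root_tuples_root_of_unity_tendsto_0[OF L] by blast
next
  case False
  have le: "real (card (root_tuples L \<alpha> n)) / real L ^ n \<le> 2 / real n" if "n \<ge> 1" for n
  proof -
    have "n * card (root_tuples L \<alpha> n) \<le> 2 * L ^ n"
      by (rule card_root_tuples_le_non_root_of_unity[OF L \<alpha>]) (use False in blast)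
    hence "real (n * card (root_tuples L \<alpha> n)) \<le> real (2 * L ^ n)" by (rule of_nat_mono)
    thus ?thesis using that L by (simp add: field_simps)
  qed
  show ?thesis
  proof (rule tendsto_sandwich[where f = "\<lambda>_. 0" and h = "\<lambda>n. 2 / real n"])
    show "(\<lambda>n. 2 / real n) \<longlonglongrightarrow> 0" by (rule lim_const_over_n)
    show "\<forall>\<^sub>F n in sequentially. real (card (root_tuples L \<alpha> n)) / real L ^ n \<le> 2 / real n"
      using eventually_ge_at_top[of 1] by eventually_elim (rule le)
  qed auto
qed

section \<open>Excluding factors of bounded degree\<close>

definition low_degree_tuples :: "nat \<Rightarrow> nat \<Rightarrow> nat \<Rightarrow> (nat \<Rightarrow> int) set" where
  "low_degree_tuples L K n = {c \<in> PiE {..<n} (\<lambda>_. {1..int L}).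
     \<exists>g. lead_coeff g = 1 \<and> 1 \<le> degree g \<and> degree g \<le> K \<and> g dvd mpoly n c}"

text \<open>The candidate roots form a finite set independent of n, so a union bound over them
  vanishes term by term.\<close>

lemma low_degree_tuples_tendsto_0:
  assumes L: "L \<ge> 2"
  shows "(\<lambda>n. real (card (low_degree_tuples L K n)) / real L ^ n) \<longlonglongrightarrow> 0"
proof (rule tendsto_sandwich[where f = "\<lambda>_. 0" and h = "\<lambda>n. \<Sum>\<alpha>\<in>cand_roots L K. real (card (root_tuples L \<alpha> n)) / real L ^ n"])
  show "(\<lambda>n. \<Sum>\<alpha>\<in>cand_roots L K. real (card (root_tuples L \<alpha> n)) / real L ^ n) \<longlonglongrightarrow> 0"
    by (intro tendsto_null_sum root_tuples_tendsto_0 L) (auto simp: cand_roots_def)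
  show "\<forall>\<^sub>F n in sequentially. real (card (low_degree_tuples L K n)) / real L ^ n \<le>
     (\<Sum>\<alpha>\<in>cand_roots L K. real (card (root_tuples L \<alpha> n)) / real L ^ n)"
    using eventually_ge_at_top[of 1]
  proof eventually_elim
    case (elim n)
    have fin: "finite (root_tuples L \<alpha> n)" for \<alpha> using finite_box[of n L] by (simp add: root_tuples_def)
    have "low_degree_tuples L K n \<subseteq> (\<Union>\<alpha>\<in>cand_roots L K. root_tuples L \<alpha> n)"
    proof
      fix c assume c: "c \<in> low_degree_tuples L K n"
      then obtain g where "lead_coeff g = 1" "1 \<le> degree g" "degree g \<le> K" "g dvd mpoly n c"
        unfolding low_degree_tuples_def by blast
      moreover have cb: "c \<in> PiE {..<n} (\<lambda>_. {1..int L})" using c unfolding low_degree_tuples_def by blast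
      ultimately show "c \<in> (\<Union>\<alpha>\<in>cand_roots L K. root_tuples L \<alpha> n)"
        using low_degree_factor_root[OF cb elim] unfolding root_tuples_def by blast
    qed
    hence "card (low_degree_tuples L K n) \<le> card (\<Union>\<alpha>\<in>cand_roots L K. root_tuples L \<alpha> n)"
      using fin finite_cand_roots by (intro card_mono finite_UN_I)
    also have "\<dots> \<le> (\<Sum>\<alpha>\<in>cand_roots L K. card (root_tuples L \<alpha> n))"
      by (intro card_UN_le finite_cand_roots)
    finally have "real (card (low_degree_tuples L K n)) \<le> (\<Sum>\<alpha>\<in>cand_roots L K. real (card (root_tuples L \<alpha> n)))"
      by (simp flip: of_nat_sum)
    thus ?case by (simp add: divide_right_mono flip: sum_divide_distrib)
  qed
qed auto

section \<open>Independence modulo four primes and conclusion\<close>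

lemma prod_primes_dvd:
  assumes "finite J" "\<And>p. p \<in> J \<Longrightarrow> prime p" "\<And>p. p \<in> J \<Longrightarrow> int p dvd x"
  shows "int (\<Prod>J) dvd x"
  using assms
proof (induction J)
  case (insert p J)
  have "coprime p (\<Prod>q\<in>J. q)"
    using insert by (intro prod_coprime_right primes_coprime) auto
  hence "coprime (int p) (int (\<Prod>J))" by (simp only: coprime_int_iff)
  hence "int p * int (\<Prod>J) dvd x" using insert by (intro divides_mult) auto
  thus ?case using insert by simp
qed simp

lemma card_residue_class_le:
  assumes "N > 0" "N dvd L" "S \<subseteq> {1..int L}" "\<And>x y. x \<in> S \<Longrightarrow> y \<in> S \<Longrightarrow> int N dvd x - y"
  shows "card S \<le> L div N"
proof -
  have "card S \<le> card {0..<int (L div N)}"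
  \<comment> \<open>The shift by 1 aligns {1..L} with L / N blocks of length N, each of which meets
    a residue class once.\<close>
  proof (rule card_inj_on_le[where f = "\<lambda>x. (x - 1) div int N"])
    show "inj_on (\<lambda>x. (x - 1) div int N) S"
    proof (rule inj_onI)
      fix x y assume xy: "x \<in> S" "y \<in> S" "(x - 1) div int N = (y - 1) div int N"
      have "(x - 1) mod int N = (y - 1) mod int N"
        using assms(4)[OF xy(1,2)] by (simp add: mod_eq_dvd_iff)
      hence "x - 1 = y - 1" using xy(3) by (metis div_mult_mod_eq)
      thus "x = y" by simp
    qed
    show "(\<lambda>x. (x - 1) div int N) ` S \<subseteq> {0..<int (L div N)}"
    proof clarify
      fix x assume "x \<in> S"
      hence x: "1 \<le> x" "x \<le> int L" using assms(3) by auto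
      have "int L = int (L div N) * int N" using assms(2) by (metis dvd_div_mult_self of_nat_mult)
      hence "x - 1 < int (L div N) * int N" using x by simp
      have "(x - 1) div int N < int (L div N)"
      proof (rule ccontr)
        assume "\<not> (x - 1) div int N < int (L div N)"
        hence "int (L div N) * int N \<le> (x - 1) div int N * int N" by (intro mult_right_mono) auto
        also have "\<dots> \<le> x - 1"
          using div_mult_mod_eq[of "x - 1" "int N"] pos_mod_sign[of "int N" "x - 1"] assms(1) by linarith
        finally show False using \<open>x - 1 < int (L div N) * int N\<close> by simp
      qed
      thus "(x - 1) div int N \<in> {0..<int (L div N)}" using x assms(1) by (simp add: pos_imp_zdiv_nonneg_iff)
    qed
  qed simp
  thus ?thesis by simp
qed

text \<open>Residues modulo the distinct primes of J fix a coordinate modulo their product N, which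
  divides L. This leaves at most L / N values per coordinate, and N ^ n splits over the primes,
  which is the independence.\<close>

lemma card_residue_box_le:
  fixes A :: "nat \<Rightarrow> (nat \<Rightarrow> int) set"
  assumes L: "L > 0" and J: "finite J" "\<And>p. p \<in> J \<Longrightarrow> prime p \<and> p dvd L"
    and A: "\<And>p. p \<in> J \<Longrightarrow> A p \<subseteq> PiE {..<n} (\<lambda>_. {0..<int p})"
  shows "real (card {c \<in> PiE {..<n} (\<lambda>_. {1..int L}). \<forall>p\<in>J. restrict (\<lambda>i. c i mod int p) {..<n} \<in> A p}) / real L ^ n
    \<le> (\<Prod>p\<in>J. real (card (A p)) / real p ^ n)"
proof -
  define N where "N = \<Prod>J"
  have N0: "N > 0" unfolding N_def using J prime_gt_0_nat by (intro prod_pos) blast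
  have "int N dvd int L" unfolding N_def using J by (intro prod_primes_dvd) auto
  hence NL: "N dvd L" by simp
  define X where "X a i = {x \<in> {1..int L}. \<forall>p\<in>J. x mod int p = a p i}" for a :: "nat \<Rightarrow> nat \<Rightarrow> int" and i
  have cardX: "card (X a i) \<le> L div N" for a i
  proof (rule card_residue_class_le[OF N0 NL])
    fix x y assume xy: "x \<in> X a i" "y \<in> X a i"
    show "int N dvd x - y" unfolding N_def
    proof (rule prod_primes_dvd)
      fix p assume "p \<in> J"
      hence "x mod int p = y mod int p" using xy by (simp add: X_def)
      thus "int p dvd x - y" by (simp add: mod_eq_dvd_iff)
    qed (use J in auto)
  qed (auto simp: X_def)
  have finX: "finite (X a i)" for a i by (rule finite_subset[of _ "{1..int L}"]) (auto simp: X_def)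
  have finA: "finite (A p)" if "p \<in> J" for p
    using A[OF that] by (rule finite_subset) (intro finite_PiE, auto)
  let ?C = "{c \<in> PiE {..<n} (\<lambda>_. {1..int L}). \<forall>p\<in>J. restrict (\<lambda>i. c i mod int p) {..<n} \<in> A p}"
  have sub: "?C \<subseteq> (\<Union>a\<in>PiE J A. PiE {..<n} (X a))"
  proof
    fix c assume c: "c \<in> ?C"
    let ?a = "restrict (\<lambda>p. restrict (\<lambda>i. c i mod int p) {..<n}) J"
    have "?a \<in> PiE J A" using c by auto
    moreover have "c \<in> PiE {..<n} (X ?a)"
      using c by (auto simp: X_def PiE_iff)
    ultimately show "c \<in> (\<Union>a\<in>PiE J A. PiE {..<n} (X a))" by blast
  qed
  have finPA: "finite (PiE J A)" using J finA by (intro finite_PiE)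
  have "card ?C \<le> card (\<Union>a\<in>PiE J A. PiE {..<n} (X a))"
    by (intro card_mono sub finite_UN_I finPA finite_PiE finX) simp
  also have "\<dots> \<le> (\<Sum>a\<in>PiE J A. card (PiE {..<n} (X a)))" by (intro card_UN_le finPA)
  also have "\<dots> \<le> (\<Sum>a\<in>PiE J A. (L div N) ^ n)"
  proof (intro sum_mono)
    fix a
    have "card (PiE {..<n} (X a)) = (\<Prod>i<n. card (X a i))" by (simp add: card_PiE)
    also have "\<dots> \<le> (\<Prod>i<n. L div N)" by (intro prod_mono) (simp add: cardX)
    finally show "card (PiE {..<n} (X a)) \<le> (L div N) ^ n" by simp
  qed
  also have "\<dots> = (\<Prod>p\<in>J. card (A p)) * (L div N) ^ n" using J by (simp add: card_PiE)
  finally have "real (card ?C) \<le> real ((\<Prod>p\<in>J. card (A p)) * (L div N) ^ n)" by (rule of_nat_mono)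
  also have "\<dots> = (\<Prod>p\<in>J. real (card (A p))) * (real L / real N) ^ n"
    using NL by (simp add: real_of_nat_div)
  also have "(real L / real N) ^ n = real L ^ n / (\<Prod>p\<in>J. real p ^ n)"
    by (simp add: N_def power_divide prod_power_distrib)
  finally have *: "real (card ?C) \<le> (\<Prod>p\<in>J. real (card (A p))) * (real L ^ n / (\<Prod>p\<in>J. real p ^ n))" .
  have "real (card ?C) / real L ^ n \<le> (\<Prod>p\<in>J. real (card (A p))) * (real L ^ n / (\<Prod>p\<in>J. real p ^ n)) / real L ^ n"
    by (intro divide_right_mono *) simp
  also have "\<dots> = (\<Prod>p\<in>J. real (card (A p))) / (\<Prod>p\<in>J. real p ^ n)" using L by simp
  also have "\<dots> = (\<Prod>p\<in>J. real (card (A p)) / real p ^ n)" by (rule prod_dividef[symmetric])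
  finally show ?thesis .
qed

text \<open>
  \<open>Bd n i0\<close> are the residues whose factorization pattern is not good, and \<open>Dv n i0 k\<close> the good ones with
  a divisor of degree \<open>k\<close>.
\<close>

definition residue_sets :: "nat \<Rightarrow> (nat \<Rightarrow> nat \<Rightarrow> (nat \<Rightarrow> int) set) \<Rightarrow> (nat \<Rightarrow> nat \<Rightarrow> nat \<Rightarrow> (nat \<Rightarrow> int) set) \<Rightarrow> bool" where
  "residue_sets p Bd Dv \<longleftrightarrow>
    (\<forall>n i0. Bd n i0 \<subseteq> PiE {..<n} (\<lambda>_. {0..<int p}) \<and>
       real (card (Bd n i0)) / real p ^ n \<le> exp (21 / 100) * tail_ratio ^ i0 / (1 - tail_ratio)) \<and>
    (\<forall>n i0 k. Dv n i0 k \<subseteq> PiE {..<n} (\<lambda>_. {0..<int p}) \<and>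
       (2 ^ i0 \<le> k \<longrightarrow> 2 * k \<le> n \<longrightarrow> real (card (Dv n i0 k)) / real p ^ n \<le> 2 * real k powr (-13/50))) \<and>
    (\<forall>n i0 c g h. lead_coeff g = 1 \<longrightarrow> lead_coeff h = 1 \<longrightarrow> mpoly n c = g * h \<longrightarrow>
       restrict (\<lambda>i. c i mod int p) {..<n} \<in> Bd n i0 \<union> Dv n i0 (degree g))"

text \<open>The bounds for multisets carry over because \<Phi> is injective on residue tuples; a
  factor g yields the sub-multiset \<Phi> g because \<Phi> (g * h) = \<Phi> g + \<Phi> h.\<close>

lemma prime_residue_sets:
  assumes "prime p"
  shows "\<exists>Bd Dv. residue_sets p Bd Dv"
proof -
  from fp_model[OF assms] obtain Pr :: "int poly set" and \<Phi> where
    ps: "prime_system Pr degree p" and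
    \<Phi>W: "\<And>f. lead_coeff f = 1 \<Longrightarrow> set_mset (\<Phi> f) \<subseteq> Pr \<and> (\<Sum>P\<in>#\<Phi> f. degree P) = degree f" and
    \<Phi>_mult: "\<And>f g. lead_coeff f = 1 \<Longrightarrow> lead_coeff g = 1 \<Longrightarrow> \<Phi> (f * g) = \<Phi> f + \<Phi> g" and
    \<Phi>_cong: "\<And>f g. (\<And>i. coeff f i mod int p = coeff g i mod int p) \<Longrightarrow> \<Phi> f = \<Phi> g" and
    \<Phi>_inj: "\<And>n. inj_on (\<Phi> \<circ> mpoly n) (PiE {..<n} (\<lambda>_. {0..<int p}))"
    unfolding fp_model_def by blast
  interpret prime_system Pr degree p by (rule ps)
  have p0: "real p ^ n > 0" for n using q_ge_2 by simp
  define R where "R n Q = {r \<in> PiE {..<n} (\<lambda>_. {0..<int p}). Q (\<Phi> (mpoly n r))}" for n Q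
  have \<Phi>_W: "\<Phi> (mpoly n r) \<in> W n" for n r
    using \<Phi>W[OF lead_coeff_mpoly, of n r] by (simp add: W_def wt_def)
  have cardR: "real (card (R n Q)) / real p ^ n \<le> b" if "real (card {M \<in> W n. Q M}) \<le> b * real p ^ n" for n Q b
  proof -
    have "card (R n Q) \<le> card {M \<in> W n. Q M}"
    proof (rule card_inj_on_le)
      show "inj_on (\<Phi> \<circ> mpoly n) (R n Q)" by (rule inj_on_subset[OF \<Phi>_inj]) (auto simp: R_def)
      show "(\<Phi> \<circ> mpoly n) ` R n Q \<subseteq> {M \<in> W n. Q M}" using \<Phi>_W by (auto simp: R_def)
    qed simp
    hence "real (card (R n Q)) \<le> b * real p ^ n" using that by linarith
    thus ?thesis using p0[of n] by (simp add: pos_divide_le_eq)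
  qed
  define Bd where "Bd n i0 = R n (\<lambda>M. \<not> good i0 M)" for n i0
  define Dv where "Dv n i0 k = R n (\<lambda>M. good i0 M \<and> (\<exists>A. A \<subseteq># M \<and> wt A = k))" for n i0 k
  show ?thesis unfolding residue_sets_def
  proof (intro exI[of _ Bd] exI[of _ Dv] conjI allI impI)
    fix n i0 k
    show "Bd n i0 \<subseteq> PiE {..<n} (\<lambda>_. {0..<int p})" "Dv n i0 k \<subseteq> PiE {..<n} (\<lambda>_. {0..<int p})"
      unfolding Bd_def Dv_def R_def by blast+
    show "real (card (Bd n i0)) / real p ^ n \<le> exp (21 / 100) * tail_ratio ^ i0 / (1 - tail_ratio)"
      unfolding Bd_def by (rule cardR) (rule card_not_good_le)
    assume "2 ^ i0 \<le> k" "2 * k \<le> n"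
    thus "real (card (Dv n i0 k)) / real p ^ n \<le> 2 * real k powr (-13/50)"
      unfolding Dv_def by (intro cardR card_good_divisor_le)
  next
    fix n i0 c and g h :: "int poly"
    assume gh: "lead_coeff g = 1" "lead_coeff h = 1" "mpoly n c = g * h"
    let ?r = "restrict (\<lambda>i. c i mod int p) {..<n}"
    have "\<Phi> (mpoly n ?r) = \<Phi> (mpoly n c)"
      by (rule \<Phi>_cong) (simp add: coeff_mpoly)
    hence "\<Phi> g \<subseteq># \<Phi> (mpoly n ?r)" using gh \<Phi>_mult by simp
    moreover have "wt (\<Phi> g) = degree g" using \<Phi>W[OF gh(1)] by (simp add: wt_def)
    moreover have "?r \<in> PiE {..<n} (\<lambda>_. {0..<int p})" using q_ge_2 by auto
    ultimately show "?r \<in> Bd n i0 \<union> Dv n i0 (degree g)"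
      unfolding Bd_def Dv_def R_def by blast
  qed
qed

text \<open>One of two factors always has degree at most n div 2; for it,
  \<open>card_good_divisor_le\<close> applies.\<close>

definition reducibles :: "nat \<Rightarrow> nat \<Rightarrow> (nat \<Rightarrow> int) set" where
  "reducibles L n = {c \<in> PiE {..<n} (\<lambda>_. {1..int L}). \<exists>g h. lead_coeff g = 1 \<and> lead_coeff h = 1 \<and>
     mpoly n c = g * h \<and> 1 \<le> degree g \<and> degree g \<le> n div 2}"

text \<open>A factor g has degree at most 2 ^ i0, or some reduction is not good, or all four
  reductions are good and share the divisor degree of g.\<close>

lemma card_reducibles_le:
  assumes L: "L > 0" and J: "card J = 4" "\<And>p. p \<in> J \<Longrightarrow> prime p \<and> p dvd L"
  shows "real (card (reducibles L n)) / real L ^ n \<le> real (card (low_degree_tuples L (2 ^ i0) n)) / real L ^ n +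
     4 * (exp (21 / 100) * tail_ratio ^ i0 / (1 - tail_ratio)) + (\<Sum>k=2^i0..n div 2. 16 * real k powr (-26/25))"
proof -
  have finJ: "finite J" using J(1) by (intro card_ge_0_finite) simp
  let ?\<tau> = "exp (21 / 100) * tail_ratio ^ i0 / (1 - tail_ratio)"
  have "\<forall>p\<in>J. \<exists>Bd Dv. residue_sets p Bd Dv"
    using prime_residue_sets J(2) by blast
  hence "\<exists>Bd. \<forall>p\<in>J. \<exists>Dv. residue_sets p (Bd p) Dv" by (rule bchoice)
  then obtain Bd where "\<forall>p\<in>J. \<exists>Dv. residue_sets p (Bd p) Dv" by (rule exE)
  hence "\<exists>Dv. \<forall>p\<in>J. residue_sets p (Bd p) (Dv p)" by (rule bchoice)
  then obtain Dv where "\<forall>p\<in>J. residue_sets p (Bd p) (Dv p)" by (rule exE)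
  hence BD: "residue_sets p (Bd p) (Dv p)" if "p \<in> J" for p using that by (rule bspec)
  have Bd: "Bd p n i0 \<subseteq> PiE {..<n} (\<lambda>_. {0..<int p})" "real (card (Bd p n i0)) / real p ^ n \<le> ?\<tau>" if "p \<in> J" for p
    using BD[OF that, unfolded residue_sets_def, THEN conjunct1, rule_format, of n i0] by simp_all
  have Dv: "Dv p n i0 k \<subseteq> PiE {..<n} (\<lambda>_. {0..<int p})"
    "2 ^ i0 \<le> k \<Longrightarrow> 2 * k \<le> n \<Longrightarrow> real (card (Dv p n i0 k)) / real p ^ n \<le> 2 * real k powr (-13/50)" if "p \<in> J" for p k
    using BD[OF that, unfolded residue_sets_def, THEN conjunct2, THEN conjunct1,
      THEN spec[of _ n], THEN spec[of _ i0], THEN spec[of _ k]] by simp_all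
  have factor_res: "restrict (\<lambda>i. c i mod int p) {..<n} \<in> Bd p n i0 \<union> Dv p n i0 (degree g)"
    if "p \<in> J" "lead_coeff g = 1" "lead_coeff h = 1" "mpoly n c = g * h" for p c g h
    by (rule BD[OF that(1), unfolded residue_sets_def, THEN conjunct2, THEN conjunct2, rule_format]) (fact that)+
  let ?box = "PiE {..<n} (\<lambda>_. {1..int L})"
  let ?res = "\<lambda>c p. restrict (\<lambda>i. c i mod int p) {..<n}"
  \<comment> \<open>The quantifier over a singleton matches \<open>card_residue_box_le\<close> for
    the single prime p.\<close>
  let ?B = "\<lambda>p. {c \<in> ?box. \<forall>p'\<in>{p}. ?res c p' \<in> Bd p' n i0}"
  let ?D = "\<lambda>k. {c \<in> ?box. \<forall>p\<in>J. ?res c p \<in> Dv p n i0 k}"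
  have sub: "reducibles L n \<subseteq> low_degree_tuples L (2 ^ i0) n \<union> (\<Union>p\<in>J. ?B p) \<union> (\<Union>k\<in>{2^i0..n div 2}. ?D k)"
  proof
    fix c assume "c \<in> reducibles L n"
    then obtain g h where c: "c \<in> ?box" and gh: "lead_coeff g = 1" "lead_coeff h = 1"
      "mpoly n c = g * h" "1 \<le> degree g" "degree g \<le> n div 2"
      unfolding reducibles_def by blast
    show "c \<in> low_degree_tuples L (2 ^ i0) n \<union> (\<Union>p\<in>J. ?B p) \<union> (\<Union>k\<in>{2^i0..n div 2}. ?D k)"
    proof (cases "degree g \<le> 2 ^ i0")
      case True
      moreover have "g dvd mpoly n c" using gh(3) by simp
      ultimately have "c \<in> low_degree_tuples L (2 ^ i0) n" using c gh unfolding low_degree_tuples_def by blast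
      thus ?thesis by blast
    next
      case False
      show ?thesis
      proof (cases "\<exists>p\<in>J. ?res c p \<in> Bd p n i0")
        case True
        thus ?thesis using c by blast
      next
        case False
        hence "\<forall>p\<in>J. ?res c p \<in> Dv p n i0 (degree g)" using factor_res gh(1-3) by blast
        moreover have "degree g \<in> {2^i0..n div 2}" using \<open>\<not> degree g \<le> 2 ^ i0\<close> gh(5) by simp
        ultimately show ?thesis using c by blast
      qed
    qed
  qed
  have finB: "finite (?B p)" and finD: "finite (?D k)" and finlow: "finite (low_degree_tuples L K n)" for p k K
    using finite_box[of n L] by (auto simp: low_degree_tuples_def)
  have "card (reducibles L n) \<le> card (low_degree_tuples L (2 ^ i0) n \<union> (\<Union>p\<in>J. ?B p) \<union> (\<Union>k\<in>{2^i0..n div 2}. ?D k))"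
    using finB finD finlow finJ by (intro card_mono sub finite_UnI finite_UN_I) auto
  also have "\<dots> \<le> card (low_degree_tuples L (2 ^ i0) n) + (\<Sum>p\<in>J. card (?B p)) + (\<Sum>k=2^i0..n div 2. card (?D k))"
    by (intro order_trans[OF card_Un_le] add_mono order_refl card_UN_le finJ finite_atLeastAtMost)
  finally have "real (card (reducibles L n)) \<le> real (card (low_degree_tuples L (2 ^ i0) n) + (\<Sum>p\<in>J. card (?B p)) + (\<Sum>k=2^i0..n div 2. card (?D k)))"
    by (rule of_nat_mono)
  hence "real (card (reducibles L n)) / real L ^ n \<le> real (card (low_degree_tuples L (2 ^ i0) n) + (\<Sum>p\<in>J. card (?B p)) + (\<Sum>k=2^i0..n div 2. card (?D k))) / real L ^ n"
    by (intro divide_right_mono) auto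
  also have "\<dots> = real (card (low_degree_tuples L (2 ^ i0) n)) / real L ^ n + (\<Sum>p\<in>J. real (card (?B p)) / real L ^ n)
     + (\<Sum>k=2^i0..n div 2. real (card (?D k)) / real L ^ n)"
    by (simp only: of_nat_add of_nat_sum add_divide_distrib sum_divide_distrib)
  also have "(\<Sum>p\<in>J. real (card (?B p)) / real L ^ n) \<le> (\<Sum>p\<in>J. ?\<tau>)"
  proof (intro sum_mono)
    fix p assume p: "p \<in> J"
    have "real (card (?B p)) / real L ^ n \<le> (\<Prod>p'\<in>{p}. real (card (Bd p' n i0)) / real p' ^ n)"
      by (rule card_residue_box_le) (use L J Bd p in auto)
    also have "\<dots> \<le> ?\<tau>" using Bd(2)[OF p] by simp
    finally show "real (card (?B p)) / real L ^ n \<le> ?\<tau>" .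
  qed
  also have "(\<Sum>p\<in>J. ?\<tau>) = 4 * ?\<tau>" by (simp add: J(1))
  also have "(\<Sum>k=2^i0..n div 2. real (card (?D k)) / real L ^ n) \<le> (\<Sum>k=2^i0..n div 2. 16 * real k powr (-26/25))"
  proof (intro sum_mono)
    fix k assume k: "k \<in> {2^i0..n div 2}"
    have "real (card (?D k)) / real L ^ n \<le> (\<Prod>p\<in>J. real (card (Dv p n i0 k)) / real p ^ n)"
      by (rule card_residue_box_le) (use L J finJ Dv in auto)
    also have "\<dots> \<le> (\<Prod>p\<in>J. 2 * real k powr (-13/50))"
      using Dv(2) k by (intro prod_mono) auto
    \<comment> \<open>Here 2 ^ 4 = 16 and 4 * (- 13/50) = - 26/25, just below the threshold - 1 for
      summability.\<close>
    also have "\<dots> = (2 * real k powr (-13/50)) ^ 4" by (simp add: J(1))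
    also have "\<dots> = 16 * (real k powr (-13/50)) ^ 4" by (simp add: power_mult_distrib)
    also have "(real k powr (-13/50)) ^ 4 = real k powr (-26/25)"
    proof -
      have "(2::nat) ^ i0 > 0" by simp
      hence "k > 0" using k by (metis atLeastAtMost_iff order_less_le_trans)
      hence "(real k powr (-13/50)) ^ 4 = (real k powr (-13/50)) powr real 4" by (subst powr_realpow) auto
      thus ?thesis by (simp add: powr_powr)
    qed
    finally show "real (card (?D k)) / real L ^ n \<le> 16 * real k powr (-26/25)" .
  qed
  finally show ?thesis by (simp add: add_mono)
qed

lemma reducibles_tendsto_0:
  assumes L: "L > 0" and J: "card J = 4" "\<And>p. p \<in> J \<Longrightarrow> prime p \<and> p dvd L"
  shows "(\<lambda>n. real (card (reducibles L n)) / real L ^ n) \<longlonglongrightarrow> 0"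
proof (rule LIMSEQ_I)
  fix e :: real assume e: "e > 0"
  have L2: "L \<ge> 2"
  proof -
    obtain p where "p \<in> J" using J(1) by fastforce
    hence "prime p" "p dvd L" using J(2) by auto
    thus ?thesis using prime_ge_2_nat dvd_imp_le L by (meson order_trans)
  qed
  let ?f = "\<lambda>k::nat. 16 * real k powr (-26/25)"
  let ?\<tau> = "\<lambda>i0. 4 * (exp (21 / 100) * tail_ratio ^ i0 / (1 - tail_ratio))"
  have "summable ?f" by (intro summable_mult) (simp add: summable_real_powr_iff)
  have e3: "e / 3 > 0" using e by simp
  obtain N1 where N1: "\<forall>n\<ge>N1. norm (\<Sum>i. ?f (i + n)) < e / 3"
    using suminf_exist_split[OF e3 \<open>summable ?f\<close>] by blast
  have r: "0 \<le> tail_ratio" "tail_ratio < 1" using tail_ratio_less_1 by (auto simp: tail_ratio_def)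
  have "?\<tau> \<longlonglongrightarrow> 4 * (exp (21 / 100) * 0 / (1 - tail_ratio))"
    using r by (intro tendsto_intros LIMSEQ_realpow_zero) auto
  hence \<tau>lim: "?\<tau> \<longlonglongrightarrow> 0" by (simp only: mult_zero_right div_0)
  obtain N2 where N2: "\<forall>i\<ge>N2. norm (?\<tau> i - 0) < e / 3"
    using LIMSEQ_D[OF \<tau>lim e3] by blast
  \<comment> \<open>Fixed before n: it makes the two errors that are uniform in n small, and only
    the low-degree term then asks for large n.\<close>
  define i0 where "i0 = max N1 N2"
  have "i0 < 2 ^ i0" by (rule less_exp)
  hence i0: "2 ^ i0 \<ge> N1" "i0 \<ge> N2" unfolding i0_def by linarith+
  have \<tau>: "?\<tau> i0 < e / 3" using N2[rule_format, OF i0(2)] by (simp only: diff_zero real_norm_def abs_less_iff)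
  have tail: "(\<Sum>k=2^i0..n div 2. ?f k) < e / 3" for n
  proof -
    have "(\<Sum>k=2^i0..n div 2. ?f k) \<le> (\<Sum>k=2^i0..<2^i0 + Suc n. ?f k)"
      by (intro sum_mono2) auto
    also have "\<dots> = (\<Sum>i<Suc n. ?f (i + 2^i0))"
      by (rule sum.reindex_bij_witness[where i = "\<lambda>i. i + 2^i0" and j = "\<lambda>k. k - 2^i0"]) auto
    also have "\<dots> \<le> (\<Sum>i. ?f (i + 2^i0))"
      by (rule sum_le_suminf[OF summable_ignore_initial_segment[OF \<open>summable ?f\<close>]]) auto
    also have "\<dots> < e / 3" using N1[rule_format, OF i0(1)] by (simp only: real_norm_def abs_less_iff)
    finally show ?thesis .
  qed
  obtain N3 where N3: "\<forall>n\<ge>N3. norm (real (card (low_degree_tuples L (2 ^ i0) n)) / real L ^ n - 0) < e / 3"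
    using LIMSEQ_D[OF low_degree_tuples_tendsto_0[OF L2] e3] by blast
  show "\<exists>no. \<forall>n\<ge>no. norm (real (card (reducibles L n)) / real L ^ n - 0) < e"
  proof (intro exI allI impI)
    fix n assume "n \<ge> N3"
    hence "real (card (low_degree_tuples L (2 ^ i0) n)) / real L ^ n < e / 3"
      using N3[rule_format, of n] by (simp only: diff_zero real_norm_def abs_less_iff)
    hence "real (card (reducibles L n)) / real L ^ n < e"
      using card_reducibles_le[OF L J, of n i0] \<tau> tail[of n] by linarith
    thus "norm (real (card (reducibles L n)) / real L ^ n - 0) < e" by simp
  qed
qed

text \<open>Leading coefficients of integer factors of a monic polynomial are both 1 or both - 1, so
  a sign change makes the factors monic. Gauss's lemma then passes to the rationals.\<close>

lemma irreducible_monic_poly: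
  assumes n: "n \<ge> 1" and c: "c \<in> PiE {..<n} (\<lambda>_. {1..int L})" "c \<notin> reducibles L n"
  shows "irreducible (monic_poly n c)"
proof -
  let ?f = "mpoly n c"
  have "irreducible\<^sub>d ?f"
  proof (rule irreducible\<^sub>dI2)
    show "degree ?f > 0" using n by simp
    fix g :: "int poly" assume g: "degree g > 0" "degree g \<le> degree ?f div 2"
    show "\<not> g dvd ?f"
    proof
      assume "g dvd ?f"
      then obtain h where h: "?f = g * h" by (elim dvdE)
      have "lead_coeff g * lead_coeff h = 1" using h lead_coeff_mpoly[of n c] by (metis lead_coeff_mult)
      then consider "lead_coeff g = 1" "lead_coeff h = 1" | "lead_coeff g = -1" "lead_coeff h = -1"
        by (metis zmult_eq_1_iff)
      hence "c \<in> reducibles L n"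
      proof cases
        case 1
        moreover have "1 \<le> degree g" "degree g \<le> n div 2" using g by simp_all
        ultimately show ?thesis using c(1) h unfolding reducibles_def by blast
      next
        case 2
        have "?f = (- g) * (- h)" using h by simp
        moreover have "lead_coeff (- g) = 1" "lead_coeff (- h) = 1" using 2 by simp_all
        moreover have "1 \<le> degree (- g)" "degree (- g) \<le> n div 2" using g by simp_all
        ultimately show ?thesis using c(1) unfolding reducibles_def by blast
      qed
      thus False using c(2) by blast
    qed
  qed
  hence "irreducible (of_int_poly ?f :: rat poly)"
    using irreducible\<^sub>d_int_rat by (simp flip: irreducible_connect_field)
  also have "of_int_poly ?f = monic_poly n c"
    by (rule poly_eqI) (simp add: coeff_map_poly coeff_mpoly monic_poly_def coeff_sum)
  finally show ?thesis .
qed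

text \<open>The events \<open>E c\<close> for c in the box outside \<open>reducibles\<close> are
  disjoint, have probability 1 / L ^ n each, and force irreducibility.\<close>

lemma (in prob_space) prob_irreducible_ge:
  assumes L: "L > 0" and n: "n \<ge> 1" and indep: "indep_vars (\<lambda>_. count_space UNIV) X {..<n}"
    and dist: "\<And>i. i < n \<Longrightarrow> distr M (count_space UNIV) (X i) = measure_pmf (pmf_of_set {1..int L})"
  shows "prob {\<omega> \<in> space M. irreducible (monic_poly n (\<lambda>i. X i \<omega>))} \<ge> 1 - real (card (reducibles L n)) / real L ^ n"
proof -
  define E where "E c = {\<omega> \<in> space M. \<forall>i<n. X i \<omega> = c i}" for c
  have X: "X i \<in> measurable M (count_space UNIV)" if "i < n" for i
    using indep that unfolding indep_vars_def by auto
  have ne: "{..<n} \<noteq> {}" using n by (auto intro!: exI[of _ 0] simp: set_eq_iff)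
  have E_Int: "E c = (\<Inter>i\<in>{..<n}. X i -` {c i} \<inter> space M)" for c
    using ne by (auto simp: E_def)
  have E_events: "E c \<in> events" for c
    unfolding E_Int using ne by (intro sets.finite_INT measurable_sets[OF X]) auto
  have prob_E: "prob (E c) = 1 / real L ^ n" if c: "c \<in> PiE {..<n} (\<lambda>_. {1..int L})" for c
  proof -
    have "prob (E c) = (\<Prod>i<n. prob (X i -` {c i} \<inter> space M))"
      unfolding E_Int using ne by (intro indep_varsD_finite[OF indep]) auto
    also have "\<dots> = (\<Prod>i<n. 1 / real L)"
    proof (intro prod.cong refl)
      fix i assume i: "i \<in> {..<n}"
      have "prob (X i -` {c i} \<inter> space M) = measure (distr M (count_space UNIV) (X i)) {c i}"
        using X i by (simp add: measure_distr)
      also have "\<dots> = pmf (pmf_of_set {1..int L}) (c i)" using dist i by (simp add: measure_pmf_single)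
      also have "\<dots> = 1 / real L"
      proof -
        have "c i \<in> {1..int L}" using c i by (rule PiE_mem)
        thus ?thesis using L by (subst pmf_of_set) (auto simp: indicator_def)
      qed
      finally show "prob (X i -` {c i} \<inter> space M) = 1 / real L" .
    qed
    finally show ?thesis by (simp add: power_one_over)
  qed
  let ?R = "{\<omega> \<in> space M. irreducible (monic_poly n (\<lambda>i. X i \<omega>))}"
  have mp_cong: "monic_poly n c = monic_poly n d" if "\<And>i. i < n \<Longrightarrow> c i = d i" for c d
    using that unfolding monic_poly_def by (intro arg_cong2[where f = "(+)"] refl sum.cong) auto
  have E_R: "E c \<subseteq> ?R" if "irreducible (monic_poly n c)" for c
  proof
    fix \<omega> assume \<omega>: "\<omega> \<in> E c"
    hence "monic_poly n (\<lambda>i. X i \<omega>) = monic_poly n c" by (intro mp_cong) (simp add: E_def)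
    thus "\<omega> \<in> ?R" using that \<omega> by (simp add: E_def)
  qed
  have R_events: "?R \<in> events"
  proof -
    \<comment> \<open>The X i lie in {1..L} only almost surely, so measurability needs the countable
      union over all integer tuples, not just the box.\<close>
    let ?I = "{c \<in> PiE {..<n} (\<lambda>_. UNIV :: int set). irreducible (monic_poly n c)}"
    have "countable (PiE {..<n} (\<lambda>_. UNIV :: int set))" by (intro countable_PiE) auto
    hence "countable ?I" by (rule countable_subset[rotated]) auto
    hence "(\<Union>c\<in>?I. E c) \<in> events" using E_events by (intro sets.countable_UN') auto
    also have "(\<Union>c\<in>?I. E c) = ?R"
    proof (intro equalityI subsetI)
      fix \<omega> assume "\<omega> \<in> (\<Union>c\<in>?I. E c)"
      thus "\<omega> \<in> ?R" using E_R by blast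
    next
      fix \<omega> assume \<omega>: "\<omega> \<in> ?R"
      let ?c = "restrict (\<lambda>i. X i \<omega>) {..<n}"
      have "monic_poly n ?c = monic_poly n (\<lambda>i. X i \<omega>)" by (rule mp_cong) simp
      hence "?c \<in> ?I" using \<omega> by simp
      moreover have "\<omega> \<in> E ?c" using \<omega> by (simp add: E_def)
      ultimately show "\<omega> \<in> (\<Union>c\<in>?I. E c)" by blast
    qed
    finally show ?thesis .
  qed
  let ?box = "PiE {..<n} (\<lambda>_. {1..int L})"
  let ?G = "?box - reducibles L n"
  have red: "reducibles L n \<subseteq> ?box" by (auto simp: reducibles_def)
  have finG: "finite ?G" using finite_box[of n L] by simp
  have disj: "disjoint_family_on E ?G"
    unfolding disjoint_family_on_def
  proof (intro ballI impI)
    fix c d assume cd: "c \<in> ?G" "d \<in> ?G" "c \<noteq> d"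
    show "E c \<inter> E d = {}"
    proof (rule ccontr)
      assume "E c \<inter> E d \<noteq> {}"
      then obtain \<omega> where "\<omega> \<in> E c" "\<omega> \<in> E d" by blast
      hence "c i = d i" if "i \<in> {..<n}" for i using that by (simp add: E_def)
      hence "c = d" using cd PiE_ext by (metis DiffD1)
      thus False using cd by simp
    qed
  qed
  have "1 - real (card (reducibles L n)) / real L ^ n = real (card ?G) / real L ^ n"
  proof -
    have "card ?G = card ?box - card (reducibles L n)"
      using red finite_box[of n L] by (intro card_Diff_subset finite_subset[OF red]) auto
    moreover have "card (reducibles L n) \<le> card ?box" using red finite_box[of n L] by (intro card_mono)
    ultimately have "real (card ?G) = real L ^ n - real (card (reducibles L n))"
      by (simp add: card_box of_nat_diff)
    thus ?thesis using L by (simp add: diff_divide_distrib)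
  qed
  also have "\<dots> = (\<Sum>c\<in>?G. prob (E c))" using prob_E by simp
  also have "\<dots> = prob (\<Union>c\<in>?G. E c)"
    using E_events by (intro finite_measure_finite_Union[symmetric] finG disj) auto
  also have "\<dots> \<le> prob ?R"
  proof (rule finite_measure_mono[OF _ R_events])
    show "(\<Union>c\<in>?G. E c) \<subseteq> ?R" using E_R irreducible_monic_poly[OF n] by blast
  qed
  finally show ?thesis .
qed

theorem theorem1:
  fixes L :: nat
    and M :: "nat \<Rightarrow> 'a measure"
    and \<zeta> :: "nat \<Rightarrow> nat \<Rightarrow> 'a \<Rightarrow> int"
  assumes "L > 0"
    and "card {p. prime p \<and> p dvd L} \<ge> 4"
    and "\<And>n. n \<ge> 1 \<Longrightarrow> prob_space (M n)"
    and "\<And>n. n \<ge> 1 \<Longrightarrow> prob_space.indep_vars (M n) (\<lambda>_. count_space UNIV) (\<zeta> n) {..<n}"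
    and "\<And>n i. n \<ge> 1 \<Longrightarrow> i < n \<Longrightarrow>
           distr (M n) (count_space UNIV) (\<zeta> n i) = measure_pmf (pmf_of_set {1..int L})"
  shows "(\<lambda>n. measure (M n) {\<omega> \<in> space (M n). irreducible (monic_poly n (\<lambda>i. \<zeta> n i \<omega>))})
           \<longlonglongrightarrow> 1"
proof -
  let ?P = "\<lambda>n. measure (M n) {\<omega> \<in> space (M n). irreducible (monic_poly n (\<lambda>i. \<zeta> n i \<omega>))}"
  let ?r = "\<lambda>n. real (card (reducibles L n)) / real L ^ n"
  obtain J where J: "J \<subseteq> {p. prime p \<and> p dvd L}" "card J = 4"
    using obtain_subset_with_card_n[OF assms(2)] by metis
  have "?r \<longlonglongrightarrow> 0" using J by (intro reducibles_tendsto_0[OF assms(1) J(2)]) auto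
  hence lim: "(\<lambda>n. 1 - ?r n) \<longlonglongrightarrow> 1" using tendsto_diff[OF tendsto_const[of 1]] by fastforce
  show ?thesis
  proof (rule tendsto_sandwich[OF _ _ lim tendsto_const])
    show "\<forall>\<^sub>F n in sequentially. 1 - ?r n \<le> ?P n"
      using eventually_ge_at_top[of 1]
      by eventually_elim (intro prob_space.prob_irreducible_ge assms)
    show "\<forall>\<^sub>F n in sequentially. ?P n \<le> 1"
      using eventually_ge_at_top[of 1]
      by eventually_elim (intro prob_space.prob_le_1 assms)
  qed
qed

end
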